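(* Let $\Lambda=\{\lambda_1,\lambda_2,\ldots\}$ be a countable set of distinct real numbers which has an integral basis, let $f\in\mathcal{D}_{\Lambda}$ be an almost periodic function in an open vertical strip $U$, and let $\sigma_0=\operatorname{Re}s_0$ with $s_0\in U$. Then: i) If $f_1\sim f$, then $\operatorname{Img}\left(f_1(\sigma_0+it)\right)\subset\overline{\operatorname{Img}\left(f(\sigma_0+it)\right)}$ and $$\overline{\operatorname{Img}\left(f(\sigma_0+it)\right)}=\overline{\operatorname{Img}\left(f_1(\sigma_0+it)\right)}.$$ ii) $\displaystyle\operatorname{Img}\left(F_f(\sigma_0,\mathbf{x})\right)=\bigcup_{f_k\sim f}\operatorname{Img}\left(f_k(\sigma_0+it)\right)$, where the union is over all functions $f_k\in AP(U,\mathbb{C})\cap\mathcal{D}_\Lambda$ equivalent to $f$.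
   Context: Almost periodic functions. Let $U=\{s\in\mathbb{C}:\alpha<\operatorname{Re}s<\beta\}$ with $-\infty\le\alpha<\beta\le\infty$. $AP(U,\mathbb{C})$ is the set of functions $f:U\to\mathbb{C}$ which can be approximated uniformly on every reduced strip $\{\alpha_1\le\operatorname{Re}s\le\beta_1\}$, $\alpha<\alpha_1<\beta_1<\beta$, by exponential polynomials $a_1e^{\lambda_1s}+\cdots+a_ne^{\lambda_ns}$ with $a_j\in\mathbb{C}$ and $\lambda_j\in\mathbb{R}$. The Dirichlet series of $f\in AP(U,\mathbb{C})$ is the formal exponential sum $\sum_{\lambda}a(\lambda)e^{\lambda s}$ with $a(\lambda)=\lim_{T\to\infty}\frac{1}{2T}\int_{-T}^{T}f(\sigma+it)e^{-\lambda(\sigma+it)}\,dt$, which does not depend on $\sigma\in(\alpha,\beta)$ and is nonzero for at most countably many real $\lambda$; it determines $f$. The class $\mathcal{D}_\Lambda$. For a countable set $\Lambda=\{\lambda_1,\lambda_2,\ldots\}$ of distinct real numbers, $\mathcal{D}_\Lambda$ consists of the functions $f\in AP(U,\mathbb{C})$ (for such a strip $U$) whose Dirichlet series is of the form $\sum_{j\ge1}a_je^{\lambda_js}$, $a_j\in\mathbb{C}$, $\lambda_j\in\Lambda$. Integral basis. An integral basis for $\Lambda$ is a basis $G_\Lambda=\{g_1,g_2,\ldots\}$ of the $\mathbb{Q}$-vector space $V\subset\mathbb{R}$ generated by $\Lambda$ such that every $\lambda_j$ is a finite linear combination of the $g_k$ with integer coefficients: $\lambda_j=\langle\mathbf{r}_j,\mathbf{g}\rangle=\sum_{k=1}^{q_j}r_{j,k}g_k$,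 $r_{j,k}\in\mathbb{Z}$, $\mathbf{g}=(g_1,g_2,\ldots)$. Equivalence. Two functions in $\mathcal{D}_\Lambda$ (almost periodic in the same strip) with Dirichlet series $\sum_{j\ge1}a_je^{\lambda_js}$ and $\sum_{j\ge1}b_je^{\lambda_js}$ are equivalent (written $\sim$) if there is a $\mathbb{Q}$-linear map $\psi:V\to\mathbb{R}$ such that $b_j=a_je^{i\psi(\lambda_j)}$ for all $j\ge1$. Auxiliary function. Let $f\in\mathcal{D}_\Lambda$ be almost periodic in $U$ with Dirichlet series $\sum_{j\ge1}a_je^{\lambda_js}$, and let $G_\Lambda$ be an integral basis for $\Lambda$. The auxiliary function $F_f:(\alpha,\beta)\times\mathbb{R}^{\sharp G_\Lambda}\to\mathbb{C}$ relative to $G_\Lambda$ is $$F_f(\sigma,\mathbf{x})=\sum_{j\ge1}a_je^{\lambda_j\sigma}e^{i\langle\mathbf{r}_j,\mathbf{x}\rangle},\qquad \langle\mathbf{r}_j,\mathbf{x}\rangle=\sum_{k=1}^{q_j}r_{j,k}x_k,$$ the series being summed by the Bochner–Fejér procedure, applied at $t=0$ to the exponential sum $\sum_{j\ge1}a_je^{i\langle\mathbf{r}_j,\mathbf{x}\rangle}e^{\lambda_js}$, $s=\sigma+it$. Concretely, it is $\lim_{k\to\infty}\sum_{j}p_{j,k}a_je^{i\langle\mathbf{r}_j,\mathbf{x}\rangle}e^{\lambda_j\sigma}$, where one may take the Bochner–Fejér factors $p_{j,k}=\prod_{m\le k}\left(1-|r_{j,m}|/k!\right)$ if $r_{j,m}=0$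 for all $m>k$ and $|r_{j,m}|<k!$ for all $m\le k$, and $p_{j,k}=0$ otherwise (products over $m\le\min(k,\sharp G_\Lambda)$). It is known that for each $\mathbf{x}$ the sum $\sum_{j\ge1}a_je^{i\langle\mathbf{r}_j,\mathbf{x}\rangle}e^{\lambda_js}$ is the Dirichlet series of a unique function $f_{\mathbf{x}}\in AP(U,\mathbb{C})$, so that $F_f(\sigma,\mathbf{x})=f_{\mathbf{x}}(\sigma)$. Image sets. $\operatorname{Img}(f(\sigma_0+it)):=\{f(\sigma_0+it):t\in\mathbb{R}\}$ and $\operatorname{Img}(F_f(\sigma_0,\mathbf{x})):=\{F_f(\sigma_0,\mathbf{x}):\mathbf{x}\in\mathbb{R}^{\sharp G_\Lambda}\}$, where $G_\Lambda$ is any integral basis for $\Lambda$ (the set does not depend on the choice). The bar denotes closure in $\mathbb{C}$. *)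

theory Defs
  imports "HOL-Analysis.Analysis"
begin

definition vstrip :: "ereal \<Rightarrow> ereal \<Rightarrow> complex set" where
  "vstrip \<alpha> \<beta> = {s. \<alpha> < ereal (Re s) \<and> ereal (Re s) < \<beta>}"

definition exponential_polynomial :: "(complex \<Rightarrow> complex) \<Rightarrow> bool" where
  "exponential_polynomial P \<longleftrightarrow>
     (\<exists>(n::nat) (a :: nat \<Rightarrow> complex) (\<mu> :: nat \<Rightarrow> real).
        P = (\<lambda>s. \<Sum>j<n. a j * exp (of_real (\<mu> j) * s)))"

text \<open>
  A function on the strip is represented by a total function; every notion below depends only
  on its values in \<^term>\<open>vstrip \<alpha> \<beta>\<close>.
\<close>

definition AP :: "ereal \<Rightarrow> ereal \<Rightarrow> (complex \<Rightarrow> complex) set" where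
  "AP \<alpha> \<beta> = {f. \<forall>\<alpha>1 \<beta>1 :: real. \<alpha> < ereal \<alpha>1 \<and> \<alpha>1 < \<beta>1 \<and> ereal \<beta>1 < \<beta> \<longrightarrow>
      (\<forall>\<epsilon>>0. \<exists>P. exponential_polynomial P \<and>
         (\<forall>s. \<alpha>1 \<le> Re s \<and> Re s \<le> \<beta>1 \<longrightarrow> cmod (f s - P s) < \<epsilon>))}"

text \<open>
  The coefficient at \<open>l\<close> of the Dirichlet series: the mean value below has the same limit on
  every vertical line of the strip.
\<close>

definition dirichlet_coeff :: "ereal \<Rightarrow> ereal \<Rightarrow> (complex \<Rightarrow> complex) \<Rightarrow> real \<Rightarrow> complex" where
  "dirichlet_coeff \<alpha> \<beta> f l =
     (THE a. \<forall>\<sigma>::real. \<alpha> < ereal \<sigma> \<and> ereal \<sigma> < \<beta> \<longrightarrow>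
        ((\<lambda>T::real. integral {-T..T} (\<lambda>t. f (Complex \<sigma> t) * exp (- of_real l * Complex \<sigma> t))
                      / of_real (2 * T)) \<longlongrightarrow> a) at_top)"

definition D_class :: "ereal \<Rightarrow> ereal \<Rightarrow> real set \<Rightarrow> (complex \<Rightarrow> complex) set" where
  "D_class \<alpha> \<beta> \<Lambda> = {f \<in> AP \<alpha> \<beta>. \<forall>l. dirichlet_coeff \<alpha> \<beta> f l \<noteq> 0 \<longrightarrow> l \<in> \<Lambda>}"

definition rat_scale :: "rat \<Rightarrow> real \<Rightarrow> real" where
  "rat_scale q x = of_rat q * x"

global_interpretation rat_vs: vector_space rat_scale
  by unfold_locales (simp_all add: rat_scale_def algebra_simps of_rat_add of_rat_mult)

text \<open>
  Bases are enumerated as \<open>g 0, g 1, \<dots>\<close> (counting from 0), the number \<open>N\<close> of elements being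
  finite or \<open>\<infinity>\<close>.
\<close>

definition basis_index :: "enat \<Rightarrow> nat set" where
  "basis_index N = {k. enat k < N}"

definition is_int_coords :: "enat \<Rightarrow> (nat \<Rightarrow> real) \<Rightarrow> real \<Rightarrow> (nat \<Rightarrow> int) \<Rightarrow> bool" where
  "is_int_coords N g l r \<longleftrightarrow>
     finite {k. r k \<noteq> 0} \<and> {k. r k \<noteq> 0} \<subseteq> basis_index N \<and>
     l = (\<Sum>k | r k \<noteq> 0. of_int (r k) * g k)"

definition integral_basis :: "real set \<Rightarrow> enat \<Rightarrow> (nat \<Rightarrow> real) \<Rightarrow> bool" where
  "integral_basis \<Lambda> N g \<longleftrightarrow>
     inj_on g (basis_index N) \<and>
     rat_vs.independent (g ` basis_index N) \<and>
     rat_vs.span (g ` basis_index N) = rat_vs.span \<Lambda> \<and>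
     (\<forall>l\<in>\<Lambda>. \<exists>r. is_int_coords N g l r)"

definition int_coords :: "enat \<Rightarrow> (nat \<Rightarrow> real) \<Rightarrow> real \<Rightarrow> nat \<Rightarrow> int" where
  "int_coords N g l = (THE r. is_int_coords N g l r)"

definition rat_linear_on :: "real set \<Rightarrow> (real \<Rightarrow> real) \<Rightarrow> bool" where
  "rat_linear_on V \<psi> \<longleftrightarrow>
     (\<forall>x\<in>V. \<forall>y\<in>V. \<psi> (x + y) = \<psi> x + \<psi> y) \<and>
     (\<forall>q. \<forall>x\<in>V. \<psi> (rat_scale q x) = rat_scale q (\<psi> x))"

definition dirichlet_equiv ::
  "ereal \<Rightarrow> ereal \<Rightarrow> real set \<Rightarrow> (complex \<Rightarrow> complex) \<Rightarrow> (complex \<Rightarrow> complex) \<Rightarrow> bool" where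
  "dirichlet_equiv \<alpha> \<beta> \<Lambda> f1 f \<longleftrightarrow>
     f1 \<in> D_class \<alpha> \<beta> \<Lambda> \<and> f \<in> D_class \<alpha> \<beta> \<Lambda> \<and>
     (\<exists>\<psi>. rat_linear_on (rat_vs.span \<Lambda>) \<psi> \<and>
        (\<forall>l\<in>\<Lambda>. dirichlet_coeff \<alpha> \<beta> f1 l =
                 dirichlet_coeff \<alpha> \<beta> f l * exp (\<i> * of_real (\<psi> l))))"

text \<open>
  The factor of order \<open>k\<close> of an exponent with coordinates \<open>r\<close>.  Coordinates outside the index
  set of the basis vanish, so they contribute factors 1.
\<close>

definition bochner_fejer_factor :: "nat \<Rightarrow> (nat \<Rightarrow> int) \<Rightarrow> real" where
  "bochner_fejer_factor k r =
     (if (\<forall>m\<ge>k. r m = 0) \<and> (\<forall>m<k. \<bar>r m\<bar> < fact k)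
      then \<Prod>m<k. 1 - of_int \<bar>r m\<bar> / fact k
      else 0)"

text \<open>
  Only finitely many exponents have a nonzero factor of order \<open>k\<close>, as there are finitely many
  admissible coordinate vectors.  The sum is taken over exactly these exponents, because a sum
  over an infinite set would be 0 by convention.
\<close>

definition aux_fun ::
  "ereal \<Rightarrow> ereal \<Rightarrow> real set \<Rightarrow> enat \<Rightarrow> (nat \<Rightarrow> real) \<Rightarrow> (complex \<Rightarrow> complex)
     \<Rightarrow> real \<Rightarrow> (nat \<Rightarrow> real) \<Rightarrow> complex" where
  "aux_fun \<alpha> \<beta> \<Lambda> N g f \<sigma> x =
     lim (\<lambda>k. \<Sum>l | l \<in> \<Lambda> \<and> bochner_fejer_factor k (int_coords N g l) \<noteq> 0.
            of_real (bochner_fejer_factor k (int_coords N g l)) * dirichlet_coeff \<alpha> \<beta> f l *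
            exp (\<i> * of_real (\<Sum>m | int_coords N g l m \<noteq> 0. of_int (int_coords N g l m) * x m)) *
            of_real (exp (l * \<sigma>)))"

definition Img_line :: "(complex \<Rightarrow> complex) \<Rightarrow> real \<Rightarrow> complex set" where
  "Img_line f \<sigma> = range (\<lambda>t. f (Complex \<sigma> t))"

definition Img_aux ::
  "ereal \<Rightarrow> ereal \<Rightarrow> real set \<Rightarrow> enat \<Rightarrow> (nat \<Rightarrow> real) \<Rightarrow> (complex \<Rightarrow> complex)
     \<Rightarrow> real \<Rightarrow> complex set" where
  "Img_aux \<alpha> \<beta> \<Lambda> N g f \<sigma> = aux_fun \<alpha> \<beta> \<Lambda> N g f \<sigma> ` (basis_index N \<rightarrow>\<^sub>E UNIV)"

end

theory Submission
  imports Defs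
begin

text \<open>
  Let \<open>S k f x\<close> be the Bochner-Fejer sum of order \<open>k\<close> of \<open>f\<close> in which each term is rotated by the
  pairing of the integer coordinates of its exponent with \<open>x\<close>. On a vertical line it is a mean
  value of \<open>f\<close> against a product of translated Fejer kernels, which is nonnegative and has mean 1
  because the \<open>g m\<close> are independent; hence \<open>\<bar>S k f x\<bar>\<close> is bounded by the supremum of \<open>\<bar>f\<bar>\<close> on the
  line, uniformly in \<open>k\<close> and \<open>x\<close>. Approximating \<open>f\<close> by exponential polynomials, \<open>S k f x\<close> therefore
  converges uniformly on reduced strips to an almost periodic function with the rotated Dirichlet
  series. By uniqueness of the Dirichlet series these limits are exactly the functions equivalent
  to \<open>f\<close>, and a vertical shift by \<open>t\<close> amounts to replacing \<open>x\<close> by \<open>x + t g\<close>; this gives (ii).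
  By Kronecker's theorem the points \<open>t g\<close> are dense in the torus of the first \<open>k\<close> coordinates, so
  every value of a rotated sum is a limit of values of the unrotated sum on the same line; this
  gives (i).
\<close>

subsection \<open>Mean values and Fejer kernels\<close>

text \<open>Pairs \<open>r\<close> with \<open>-r\<close>. Writing the positive index as
  \<open>n - j\<close> with \<open>j < n\<close> gives the summands the form of the cross terms in
  the square of a sum of \<open>cis (real j * \<theta>)\<close>.\<close>

lemma sum_symmetric_int_interval:
  fixes h :: "int \<Rightarrow> 'a::comm_monoid_add"
  shows "(\<Sum>r\<in>{- int n..int n}. h r) = h 0 + (\<Sum>j<n. h (int n - int j) + h (int j - int n))"
proof -
  have "(\<Sum>r\<in>{- int n..int n}. h r) = h 0 + (\<Sum>j<n. h (int (Suc j)) + h (- int (Suc j)))"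
  proof (induction n)
    case (Suc n)
    have "{- int (Suc n)..int (Suc n)} = insert (int (Suc n)) (insert (- int (Suc n)) {- int n..int n})"
      by auto
    then show ?case by (simp add: Suc add_ac)
  qed simp
  also have "(\<Sum>j<n. h (int (Suc j)) + h (- int (Suc j))) = (\<Sum>j<n. h (int n - int j) + h (int j - int n))"
    by (subst sum.nat_diff_reindex[symmetric]) (auto intro!: sum.cong simp: of_nat_diff algebra_simps)
  finally show ?thesis .
qed

text \<open>Induction on \<open>n\<close>. With \<open>D\<close> the sum of the first
  \<open>n\<close> unimodular terms and \<open>z\<close> the next one, the right side grows by
  \<open>1 + cnj D * z + D * cnj z\<close>. The left side grows by the Dirichlet kernel of order
  \<open>n\<close>, which is the same expression.\<close>

lemma fejer_kernel:
  "(\<Sum>r\<in>{- int n<..<int n}. of_real (real n - \<bar>r\<bar>) * cis (of_int r * \<theta>)) =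
     of_real ((cmod (\<Sum>j<n. cis (real j * \<theta>)))\<^sup>2)"
proof (induction n)
  case (Suc n)
  let ?D = "\<Sum>j<n. cis (real j * \<theta>)" and ?z = "cis (real n * \<theta>)"
  let ?I = "{- int n..int n}"
  have I: "{- int (Suc n)<..<int (Suc n)} = ?I" by auto
  have "(\<Sum>r\<in>?I. complex_of_real (real (Suc n) - \<bar>r\<bar>) * cis (of_int r * \<theta>)) =
        (\<Sum>r\<in>?I. of_real (real n - \<bar>r\<bar>) * cis (of_int r * \<theta>)) + (\<Sum>r\<in>?I. cis (of_int r * \<theta>))"
    by (simp add: sum.distrib[symmetric] algebra_simps)
  \<comment> \<open>The endpoints \<open>n\<close> and \<open>-n\<close> carry the weight 0, so the
    closed interval may be replaced by the open one of the induction hypothesis.\<close>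
  also have "(\<Sum>r\<in>?I. complex_of_real (real n - \<bar>r\<bar>) * cis (of_int r * \<theta>)) =
             (\<Sum>r\<in>{- int n<..<int n}. of_real (real n - \<bar>r\<bar>) * cis (of_int r * \<theta>))"
  proof (rule sum.mono_neutral_right)
    show "\<forall>r\<in>?I - {- int n<..<int n}. complex_of_real (real n - \<bar>r\<bar>) * cis (of_int r * \<theta>) = 0"
    proof
      fix r assume "r \<in> ?I - {- int n<..<int n}"
      then have "r = int n \<or> r = - int n" by auto
      then show "complex_of_real (real n - \<bar>r\<bar>) * cis (of_int r * \<theta>) = 0" by auto
    qed
  qed auto
  also have "(\<Sum>r\<in>?I. cis (of_int r * \<theta>)) = 1 + cnj ?D * ?z + ?D * cnj ?z"
    unfolding sum_symmetric_int_interval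
    by (simp add: sum.distrib sum_distrib_left sum_distrib_right cis_cnj cis_mult algebra_simps)
  finally have "(\<Sum>r\<in>{- int (Suc n)<..<int (Suc n)}. complex_of_real (real (Suc n) - \<bar>r\<bar>) * cis (of_int r * \<theta>))
     = ?D * cnj ?D + (1 + cnj ?D * ?z + ?D * cnj ?z)"
    unfolding I Suc.IH complex_norm_square by simp
  also have "\<dots> = (?D + ?z) * cnj (?D + ?z)"
    by (simp add: algebra_simps cis_mult cis_cnj)
  finally show ?case
    unfolding complex_norm_square by simp
qed simp

section \<open>Mean values of functions on the real line\<close>

definition has_mean :: "(real \<Rightarrow> complex) \<Rightarrow> complex \<Rightarrow> bool" where
  "has_mean h L \<longleftrightarrow> ((\<lambda>T. integral {-T..T} h / of_real (2 * T)) \<longlongrightarrow> L) at_top"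

lemma has_mean_unique: "has_mean h L \<Longrightarrow> has_mean h L' \<Longrightarrow> L = L'"
  unfolding has_mean_def by (rule tendsto_unique) auto

lemma has_mean_add:
  assumes "has_mean h L" "has_mean h' L'" "continuous_on UNIV h" "continuous_on UNIV h'"
  shows "has_mean (\<lambda>t. h t + h' t) (L + L')"
proof -
  have "integral {-T..T} (\<lambda>t. h t + h' t) = integral {-T..T} h + integral {-T..T} h'" for T
    by (intro integral_add integrable_continuous_interval continuous_on_subset[OF assms(3)]
        continuous_on_subset[OF assms(4)]) auto
  then show ?thesis
    using tendsto_add[OF assms(1,2)[unfolded has_mean_def]]
    by (simp add: has_mean_def add_divide_distrib)
qed

lemma has_mean_cmult: "has_mean h L \<Longrightarrow> has_mean (\<lambda>t. c * h t) (c * L)"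
  unfolding has_mean_def by (auto dest: tendsto_mult_left[where c=c])

lemma has_mean_diff:
  assumes "has_mean h L" "has_mean h' L'" "continuous_on UNIV h" "continuous_on UNIV h'"
  shows "has_mean (\<lambda>t. h t - h' t) (L - L')"
  using has_mean_add[OF assms(1) has_mean_cmult[OF assms(2), of "-1"] assms(3)] assms(4)
  by (simp add: continuous_on_minus)

lemma has_mean_sum:
  assumes "finite A" "\<And>i. i \<in> A \<Longrightarrow> has_mean (h i) (L i)" "\<And>i. i \<in> A \<Longrightarrow> continuous_on UNIV (h i)"
  shows "has_mean (\<lambda>t. \<Sum>i\<in>A. h i t) (\<Sum>i\<in>A. L i)"
  using assms
proof (induction A)
  case empty
  then show ?case by (simp add: has_mean_def)
next
  case (insert a A)
  then show ?case by (auto intro!: has_mean_add continuous_on_sum)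
qed

text \<open>For nonzero frequency the antiderivative is bounded, so the average over
  \<open>{-T..T}\<close> is of order \<open>1 / T\<close>. This is the orthogonality relation behind
  all later coefficient computations.\<close>

lemma has_mean_cis: "has_mean (\<lambda>t. cis (\<nu> * t)) (if \<nu> = 0 then 1 else 0)"
proof (cases "\<nu> = 0")
  case True
  have "eventually (\<lambda>T::real. integral {-T..T} (\<lambda>t. cis (\<nu> * t)) / of_real (2 * T) = 1) at_top"
    using eventually_gt_at_top[of 0] by eventually_elim (simp add: True scaleR_conv_of_real)
  then show ?thesis
    using True by (simp add: has_mean_def tendsto_eventually)
next
  case False
  have bound: "norm (integral {-T..T} (\<lambda>t. cis (\<nu> * t)) / of_real (2 * T)) \<le> (1 / \<bar>\<nu>\<bar>) / T"
    if "T > 0" for T :: real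
  proof -
    have "((\<lambda>t. cis (\<nu> * t)) has_integral (cis (\<nu> * T) / (\<i> * \<nu>) - cis (\<nu> * (-T)) / (\<i> * \<nu>))) {-T..T}"
    proof (rule fundamental_theorem_of_calculus)
      fix t assume "t \<in> {-T..T}"
      have "((\<lambda>z. exp (\<i> * (of_real \<nu> * z)) / (\<i> * \<nu>)) has_field_derivative exp (\<i> * (of_real \<nu> * of_real t)))
          (at (of_real t))"
        using False by (auto intro!: derivative_eq_intros simp: mult_ac)
      then show "((\<lambda>t. cis (\<nu> * t) / (\<i> * \<nu>)) has_vector_derivative cis (\<nu> * t)) (at t within {-T..T})"
        unfolding cis_conv_exp of_real_mult by (rule has_vector_derivative_real_field)
    qed (use that in auto)
    then have "norm (integral {-T..T} (\<lambda>t. cis (\<nu> * t))) =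
        norm (cis (\<nu> * T) / (\<i> * \<nu>) - cis (\<nu> * (-T)) / (\<i> * \<nu>))"
      by (simp add: integral_unique)
    also have "\<dots> \<le> norm (cis (\<nu> * T) / (\<i> * \<nu>)) + norm (cis (\<nu> * (-T)) / (\<i> * \<nu>))"
      by (rule norm_triangle_ineq4)
    also have "\<dots> = 2 / \<bar>\<nu>\<bar>" by (simp add: norm_divide norm_mult)
    finally show ?thesis using that by (simp add: norm_divide norm_mult field_simps)
  qed
  have "((\<lambda>T. (1 / \<bar>\<nu>\<bar>) / T) \<longlongrightarrow> 0) at_top"
    by (intro tendsto_divide_0[OF tendsto_const] filterlim_at_top_imp_at_infinity filterlim_ident)
  moreover have "eventually (\<lambda>T. norm (integral {-T..T} (\<lambda>t. cis (\<nu> * t)) / of_real (2 * T)) \<le> (1 / \<bar>\<nu>\<bar>) / T) at_top"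
    using eventually_gt_at_top[of 0] by eventually_elim (rule bound)
  ultimately have "((\<lambda>T. integral {-T..T} (\<lambda>t. cis (\<nu> * t)) / of_real (2 * T)) \<longlongrightarrow> 0) at_top"
    by (rule Lim_null_comparison[rotated])
  then show ?thesis using False by (simp add: has_mean_def)
qed

lemma continuous_on_cis_mult [continuous_intros]: "continuous_on A (\<lambda>u. cis (c * u))"
  unfolding cis_conv_exp by (intro continuous_intros)

text \<open>The inequality holds for the averages over each \<open>{-T..T}\<close> and passes to the
  limit. The majorant may vary with \<open>t\<close>, so that it can be a nonnegative kernel and not
  only a constant.\<close>

lemma has_mean_norm_le:
  assumes h: "has_mean h L" "continuous_on UNIV h"
    and k: "has_mean (\<lambda>t. of_real (\<kappa> t)) (of_real K)" "continuous_on UNIV \<kappa>"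
    and le: "\<And>t. cmod (h t) \<le> \<kappa> t"
  shows "cmod L \<le> K"
proof -
  have "((\<lambda>T. Re (integral {-T..T} (\<lambda>t. of_real (\<kappa> t)) / of_real (2 * T))) \<longlongrightarrow> Re (of_real K)) at_top"
    using k(1) unfolding has_mean_def by (rule tendsto_Re)
  moreover have "((\<lambda>T. cmod (integral {-T..T} h / of_real (2 * T))) \<longlongrightarrow> cmod L) at_top"
    using h(1) unfolding has_mean_def by (rule tendsto_norm)
  moreover have "eventually (\<lambda>T. cmod (integral {-T..T} h / of_real (2 * T)) \<le>
      Re (integral {-T..T} (\<lambda>t. of_real (\<kappa> t)) / of_real (2 * T))) at_top"
    using eventually_gt_at_top[of 0]
  proof eventually_elim
    case (elim T)
    have ik: "\<kappa> integrable_on {-T..T}"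
      by (rule integrable_continuous_interval) (rule continuous_on_subset[OF k(2)], simp)
    have "cmod (integral {-T..T} h) \<le> integral {-T..T} \<kappa>"
      by (rule integral_norm_bound_integral)
         (auto intro!: ik le integrable_continuous_interval continuous_on_subset[OF h(2)])
    moreover have "integral {-T..T} (\<lambda>t. complex_of_real (\<kappa> t)) = of_real (integral {-T..T} \<kappa>)"
      using has_integral_of_real[OF integrable_integral[OF ik]] by (rule integral_unique)
    ultimately show ?case
      using elim by (simp add: norm_divide norm_mult divide_right_mono Re_divide_of_real)
  qed
  ultimately show ?thesis
    by (intro tendsto_le[of at_top _ "Re (of_real K)" _ "cmod L", simplified]) auto
qed

text \<open>
  Integrating \<open>h\<close> against the product of the Fejer kernels in the variables \<open>g m * u - x m\<close>:
  this product is nonnegative, and by independence of the \<open>g m\<close> its mean value is 1.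
\<close>

lemma fejer_contraction:
  fixes g x :: "'i \<Rightarrow> real" and n :: nat
  assumes I: "finite I" and n: "n > 0"
    and indep: "\<And>r. (\<Sum>m\<in>I. of_int (r m) * g m) = 0 \<Longrightarrow> (\<And>m. m \<in> I \<Longrightarrow> r m = (0::int))"
    and cont: "continuous_on UNIV h" and B: "\<And>u. cmod (h u) \<le> B"
    and H: "\<And>\<nu>. has_mean (\<lambda>u. h u * cis (- \<nu> * u)) (H \<nu>)"
  defines "R \<equiv> I \<rightarrow>\<^sub>E {- int n<..<int n}"
  shows "cmod (\<Sum>r\<in>R. of_real (\<Prod>m\<in>I. 1 - of_int \<bar>r m\<bar> / n) *
                 H (\<Sum>m\<in>I. of_int (r m) * g m) * cis (\<Sum>m\<in>I. of_int (r m) * x m)) \<le> B"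
proof -
  define w where "w = (\<lambda>r::'i \<Rightarrow> int. \<Prod>m\<in>I. 1 - of_int \<bar>r m\<bar> / real n)"
  define \<gamma> where "\<gamma> = (\<lambda>r::'i \<Rightarrow> int. \<Sum>m\<in>I. of_int (r m) * g m)"
  define \<xi> where "\<xi> = (\<lambda>r::'i \<Rightarrow> int. \<Sum>m\<in>I. of_int (r m) * x m)"
  define \<kappa> where "\<kappa> = (\<lambda>u. \<Prod>m\<in>I. (cmod (\<Sum>j<n. cis (real j * (x m - g m * u))))\<^sup>2 / n)"
  have finR: "finite R" unfolding R_def using I by (intro finite_PiE) auto
  have \<kappa>: "complex_of_real (\<kappa> u) = (\<Sum>r\<in>R. (of_real (w r) * cis (\<xi> r)) * cis (- \<gamma> r * u))" for u
  proof -
    have "complex_of_real (\<kappa> u) = (\<Prod>m\<in>I. \<Sum>r\<in>{- int n<..<int n}.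
        of_real (1 - of_int \<bar>r\<bar> / n) * cis (of_int r * (x m - g m * u)))"
      unfolding \<kappa>_def of_real_prod of_real_divide fejer_kernel[symmetric]
      using n by (intro prod.cong refl) (auto simp: sum_divide_distrib field_simps intro!: sum.cong)
    also have "\<dots> = (\<Sum>r\<in>R. \<Prod>m\<in>I. of_real (1 - of_int \<bar>r m\<bar> / n) * cis (of_int (r m) * (x m - g m * u)))"
      unfolding R_def using I by (intro prod_sum_PiE) auto
    also have "\<dots> = (\<Sum>r\<in>R. (of_real (w r) * cis (\<xi> r)) * cis (- \<gamma> r * u))"
    proof (intro sum.cong refl)
      fix r :: "'i \<Rightarrow> int"
      have "(\<Prod>m\<in>I. cis (of_int (r m) * (x m - g m * u))) = cis (\<xi> r - \<gamma> r * u)"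
        unfolding \<xi>_def \<gamma>_def sum_distrib_right sum_subtractf[symmetric] using I
        by (induction I) (auto simp: cis_mult algebra_simps)
      then show "(\<Prod>m\<in>I. of_real (1 - of_int \<bar>r m\<bar> / n) * cis (of_int (r m) * (x m - g m * u))) =
          complex_of_real (w r) * cis (\<xi> r) * cis (- \<gamma> r * u)"
        by (simp add: prod.distrib w_def cis_mult mult.assoc)
    qed
    finally show ?thesis .
  qed
  have \<kappa>0: "\<kappa> u \<ge> 0" for u unfolding \<kappa>_def by (intro prod_nonneg) auto
  have cont\<kappa>: "continuous_on UNIV \<kappa>"
    unfolding \<kappa>_def cis_conv_exp by (intro continuous_intros) (use n in auto)
  have "has_mean (\<lambda>u. \<Sum>r\<in>R. (of_real (w r) * cis (\<xi> r)) * cis (- \<gamma> r * u))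
      (\<Sum>r\<in>R. (of_real (w r) * cis (\<xi> r)) * (if - \<gamma> r = 0 then 1 else 0))"
    by (intro has_mean_sum has_mean_cmult has_mean_cis finR continuous_intros)
  \<comment> \<open>Only frequency 0 contributes to the mean, and by independence only the zero
    vector of the box has it.\<close>
  also have "(\<Sum>r\<in>R. (of_real (w r) * cis (\<xi> r)) * (if - \<gamma> r = 0 then 1 else 0)) =
      (\<Sum>r\<in>{\<lambda>m\<in>I. 0}. complex_of_real (w r) * cis (\<xi> r))"
  proof (rule sum.mono_neutral_cong_right[OF finR])
    show "{\<lambda>m\<in>I. 0} \<subseteq> R" using n by (auto simp: R_def)
    show "\<forall>r\<in>R - {\<lambda>m\<in>I. 0}. (of_real (w r) * cis (\<xi> r)) * (if - \<gamma> r = 0 then 1 else 0) = 0"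
    proof
      fix r assume r: "r \<in> R - {\<lambda>m\<in>I. 0}"
      have "\<gamma> r \<noteq> 0"
      proof
        assume "\<gamma> r = 0"
        then have "r m = 0" if "m \<in> I" for m
          using indep[OF _ that, of r] unfolding \<gamma>_def by blast
        moreover have "r \<in> extensional I" using r unfolding R_def PiE_def by blast
        ultimately have "r = (\<lambda>m\<in>I. 0)" by (intro extensionalityI[of _ I]) auto
        then show False using r by simp
      qed
      then show "(of_real (w r) * cis (\<xi> r)) * (if - \<gamma> r = 0 then 1 else 0) = 0" by simp
    qed
  qed (auto simp: \<gamma>_def)
  also have "\<dots> = 1" by (simp add: w_def \<xi>_def)
  finally have mean\<kappa>: "has_mean (\<lambda>u. of_real (\<kappa> u)) 1" unfolding \<kappa> .
  \<comment> \<open>The expansion of \<open>\<kappa>\<close>, multiplied by \<open>h\<close>, has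
    the sum to be estimated as its mean value; \<open>B * \<kappa>\<close> then majorizes
    \<open>h * \<kappa>\<close> and has mean \<open>B\<close>.\<close>
  have "has_mean (\<lambda>u. \<Sum>r\<in>R. (of_real (w r) * cis (\<xi> r)) * (h u * cis (- \<gamma> r * u)))
      (\<Sum>r\<in>R. (of_real (w r) * cis (\<xi> r)) * H (\<gamma> r))"
    by (intro has_mean_sum has_mean_cmult H finR continuous_intros cont)
  also have "(\<lambda>u. \<Sum>r\<in>R. (of_real (w r) * cis (\<xi> r)) * (h u * cis (- \<gamma> r * u))) = (\<lambda>u. h u * of_real (\<kappa> u))"
    unfolding \<kappa> by (simp add: sum_distrib_left mult_ac)
  finally have "cmod (\<Sum>r\<in>R. (of_real (w r) * cis (\<xi> r)) * H (\<gamma> r)) \<le> B"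
  proof (rule has_mean_norm_le)
    show "continuous_on UNIV (\<lambda>u. h u * of_real (\<kappa> u))"
      by (intro continuous_intros cont cont\<kappa>)
    show "has_mean (\<lambda>t. of_real (B * \<kappa> t)) (of_real B)"
      using has_mean_cmult[OF mean\<kappa>, of "of_real B"] by simp
    show "continuous_on UNIV (\<lambda>t. B * \<kappa> t)" by (intro continuous_intros cont\<kappa>)
    show "cmod (h t * of_real (\<kappa> t)) \<le> B * \<kappa> t" for t
      using \<kappa>0[of t] B[of t] by (simp add: norm_mult mult_right_mono)
  qed
  then show ?thesis by (simp add: w_def \<xi>_def \<gamma>_def mult_ac)
qed

subsection \<open>Almost periodic functions and Dirichlet coefficients\<close>

text \<open>Exponential polynomials indexed by their distinct exponents, so that
  \<open>c \<mu>\<close> is the coefficient at \<open>\<mu>\<close> itself; the enumeration in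
  \<open>exponential_polynomial\<close> may repeat exponents.\<close>

definition exp_sum :: "real set \<Rightarrow> (real \<Rightarrow> complex) \<Rightarrow> complex \<Rightarrow> complex" where
  "exp_sum S c s = (\<Sum>\<mu>\<in>S. c \<mu> * exp (of_real \<mu> * s))"

lemma exp_line: "exp (of_real \<mu> * Complex \<sigma> t) = of_real (exp (\<mu> * \<sigma>)) * cis (\<mu> * t)"
  by (simp add: Complex_eq cis_conv_exp distrib_left exp_add exp_of_real[symmetric] mult_ac)

lemma exponential_polynomial_exp_sum:
  "exponential_polynomial P \<longleftrightarrow> (\<exists>S c. finite S \<and> P = exp_sum S c)"
proof
  assume "exponential_polynomial P"
  then obtain n :: nat and a \<mu> where P: "P = (\<lambda>s. \<Sum>j<n. a j * exp (of_real (\<mu> j) * s))"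
    unfolding exponential_polynomial_def by blast
  have "P = exp_sum (\<mu> ` {..<n}) (\<lambda>l. \<Sum>j | j \<in> {..<n} \<and> \<mu> j = l. a j)"
  proof
    fix s
    show "P s = exp_sum (\<mu> ` {..<n}) (\<lambda>l. \<Sum>j | j \<in> {..<n} \<and> \<mu> j = l. a j) s"
      unfolding P exp_sum_def
      by (subst sum.image_gen[of _ _ \<mu>]) (auto simp: sum_distrib_right intro!: sum.cong)
  qed
  then show "\<exists>S c. finite S \<and> P = exp_sum S c" by (intro exI conjI) auto
next
  assume "\<exists>S c. finite S \<and> P = exp_sum S c"
  then obtain S c where S: "finite S" "P = exp_sum S c" by blast
  obtain h where h: "bij_betw h {..<card S} S"
    using ex_bij_betw_nat_finite[OF S(1)] by (auto simp: atLeast0LessThan)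
  have "P = (\<lambda>s. \<Sum>j<card S. c (h j) * exp (of_real (h j) * s))"
    unfolding S exp_sum_def
    by (intro ext sum.reindex_bij_betw[OF h, symmetric])
  then show "exponential_polynomial P" unfolding exponential_polynomial_def by (intro exI)
qed

lemma exp_sum_diff:
  assumes "finite S" "finite S'"
  shows "exp_sum S c s - exp_sum S' c' s =
    exp_sum (S \<union> S') (\<lambda>l. (if l \<in> S then c l else 0) - (if l \<in> S' then c' l else 0)) s"
proof -
  have "exp_sum S c s = exp_sum (S \<union> S') (\<lambda>l. if l \<in> S then c l else 0) s"
    "exp_sum S' c' s = exp_sum (S \<union> S') (\<lambda>l. if l \<in> S' then c' l else 0) s"
    unfolding exp_sum_def using assms by (auto intro!: sum.mono_neutral_cong_left)
  then show ?thesis by (simp add: exp_sum_def sum_subtractf algebra_simps)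
qed

lemma continuous_on_exp_sum_line: "continuous_on A (\<lambda>t. exp_sum S c (Complex \<sigma> t))"
  unfolding exp_sum_def exp_line by (intro continuous_intros)

lemma continuous_on_exp_line: "continuous_on A (\<lambda>t. exp (of_real l * Complex \<sigma> t))"
  unfolding exp_line by (intro continuous_intros)

text \<open>After multiplication by \<open>exp (- l * s)\<close> the term of exponent
  \<open>\<mu>\<close> has frequency \<open>\<mu> - l\<close>. Only \<open>\<mu> = l\<close>
  survives, and its factor \<open>exp ((\<mu> - l) * \<sigma>)\<close> is 1, so the mean is the same
  on every line.\<close>

lemma has_mean_exp_sum:
  assumes "finite S"
  shows "has_mean (\<lambda>t. exp_sum S c (Complex \<sigma> t) * exp (- of_real l * Complex \<sigma> t)) (if l \<in> S then c l else 0)"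
proof -
  have eq: "(\<lambda>t. exp_sum S c (Complex \<sigma> t) * exp (- of_real l * Complex \<sigma> t)) =
    (\<lambda>t. \<Sum>\<mu>\<in>S. (c \<mu> * of_real (exp ((\<mu> - l) * \<sigma>))) * cis ((\<mu> - l) * t))"
  proof
    fix t
    have "exp (of_real \<mu> * Complex \<sigma> t) * exp (- of_real l * Complex \<sigma> t) =
        of_real (exp ((\<mu> - l) * \<sigma>)) * cis ((\<mu> - l) * t)" for \<mu>
      using exp_line[of "\<mu> - l" \<sigma> t] by (simp add: exp_add[symmetric] algebra_simps)
    then show "exp_sum S c (Complex \<sigma> t) * exp (- of_real l * Complex \<sigma> t) =
        (\<Sum>\<mu>\<in>S. (c \<mu> * of_real (exp ((\<mu> - l) * \<sigma>))) * cis ((\<mu> - l) * t))"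
      by (simp add: exp_sum_def sum_distrib_right mult.assoc)
  qed
  have "has_mean (\<lambda>t. exp_sum S c (Complex \<sigma> t) * exp (- of_real l * Complex \<sigma> t))
      (\<Sum>\<mu>\<in>S. (c \<mu> * of_real (exp ((\<mu> - l) * \<sigma>))) * (if \<mu> - l = 0 then 1 else 0))"
    unfolding eq by (intro has_mean_sum has_mean_cmult has_mean_cis assms continuous_intros)
  also have "(\<Sum>\<mu>\<in>S. (c \<mu> * of_real (exp ((\<mu> - l) * \<sigma>))) * (if \<mu> - l = 0 then 1 else 0)) =
      (\<Sum>\<mu>\<in>S. if \<mu> = l then c \<mu> else 0)"
    by (intro sum.cong) auto
  finally show ?thesis using assms by simp
qed

text \<open>Widening the strip to the right admits the degenerate case
  \<open>\<alpha>1 = \<beta>1\<close>, that is, uniform approximation on a single vertical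
  line.\<close>

lemma AP_approx:
  assumes f: "f \<in> AP \<alpha> \<beta>" and ab: "\<alpha> < ereal \<alpha>1" "ereal \<beta>1 < \<beta>" and \<epsilon>: "\<epsilon> > 0"
  obtains S c where "finite S" "\<And>s. \<alpha>1 \<le> Re s \<Longrightarrow> Re s \<le> \<beta>1 \<Longrightarrow> cmod (f s - exp_sum S c s) < \<epsilon>"
proof (cases "\<alpha>1 \<le> \<beta>1")
  case False
  then show ?thesis using that[of "{}"] by auto
next
  case True
  then have "ereal \<alpha>1 < \<beta>" using ab(2) by (meson ereal_less_eq(3) le_less_trans)
  then have "max (ereal \<alpha>1) (ereal \<beta>1) < \<beta>" using ab by simp
  then obtain \<beta>2 where \<beta>2: "max (ereal \<alpha>1) (ereal \<beta>1) < ereal \<beta>2" "ereal \<beta>2 < \<beta>"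
    using ereal_dense2 by blast
  with f ab \<epsilon> obtain P where "exponential_polynomial P"
    "\<And>s. \<alpha>1 \<le> Re s \<Longrightarrow> Re s \<le> \<beta>2 \<Longrightarrow> cmod (f s - P s) < \<epsilon>"
    unfolding AP_def by force
  then show ?thesis using that \<beta>2(1) unfolding exponential_polynomial_exp_sum by force
qed

lemma exp_sum_AP: "finite S \<Longrightarrow> exp_sum S c \<in> AP \<alpha> \<beta>"
  unfolding AP_def exponential_polynomial_exp_sum
  by (auto intro!: exI[of _ "exp_sum S c"])

lemma AP_diff:
  assumes "f \<in> AP \<alpha> \<beta>" "h \<in> AP \<alpha> \<beta>"
  shows "(\<lambda>s. f s - h s) \<in> AP \<alpha> \<beta>"
  unfolding AP_def
proof safe
  fix \<alpha>1 \<beta>1 \<epsilon> :: real assume ab: "\<alpha> < ereal \<alpha>1" "\<alpha>1 < \<beta>1" "ereal \<beta>1 < \<beta>" and \<epsilon>: "\<epsilon> > 0"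
  then have \<epsilon>2: "\<epsilon> / 2 > 0" by simp
  obtain S c where S: "finite S" "\<And>s. \<alpha>1 \<le> Re s \<Longrightarrow> Re s \<le> \<beta>1 \<Longrightarrow> cmod (f s - exp_sum S c s) < \<epsilon> / 2"
    using AP_approx[OF assms(1) ab(1,3) \<epsilon>2] by blast
  obtain S' c' where S': "finite S'" "\<And>s. \<alpha>1 \<le> Re s \<Longrightarrow> Re s \<le> \<beta>1 \<Longrightarrow> cmod (h s - exp_sum S' c' s) < \<epsilon> / 2"
    using AP_approx[OF assms(2) ab(1,3) \<epsilon>2] by blast
  have "exponential_polynomial (\<lambda>s. exp_sum S c s - exp_sum S' c' s)"
    unfolding exponential_polynomial_exp_sum exp_sum_diff[OF S(1) S'(1)] using S(1) S'(1)
    by (intro exI[of _ "S \<union> S'"] exI conjI) (auto intro: refl)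
  moreover have "cmod (f s - h s - (exp_sum S c s - exp_sum S' c' s)) < \<epsilon>"
    if "\<alpha>1 \<le> Re s" "Re s \<le> \<beta>1" for s
    using norm_triangle_ineq4[of "f s - exp_sum S c s" "h s - exp_sum S' c' s"] S(2)[OF that] S'(2)[OF that]
    by (simp add: algebra_simps)
  ultimately show "\<exists>P. exponential_polynomial P \<and>
      (\<forall>s. \<alpha>1 \<le> Re s \<and> Re s \<le> \<beta>1 \<longrightarrow> cmod (f s - h s - P s) < \<epsilon>)" by blast
qed

text \<open>On the line \<open>f\<close> is a uniform limit of exponential polynomials, which are
  continuous. Continuity makes the integrals in the mean values exist.\<close>

lemma AP_continuous_line:
  assumes f: "f \<in> AP \<alpha> \<beta>" and \<sigma>: "\<alpha> < ereal \<sigma>" "ereal \<sigma> < \<beta>"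
  shows "continuous_on A (\<lambda>t. f (Complex \<sigma> t))"
proof -
  have "\<exists>S c. finite S \<and> (\<forall>t. cmod (f (Complex \<sigma> t) - exp_sum S c (Complex \<sigma> t)) < inverse (Suc n))" for n
    using AP_approx[OF f \<sigma>, of "inverse (Suc n)"] by (metis complex.sel(1) inverse_positive_iff_positive
        of_nat_0_less_iff order_refl zero_less_Suc)
  then obtain S c where Sc: "\<And>n t. cmod (f (Complex \<sigma> t) - exp_sum (S n) (c n) (Complex \<sigma> t)) < inverse (Suc n)"
    by metis
  have "uniform_limit A (\<lambda>n t. exp_sum (S n) (c n) (Complex \<sigma> t)) (\<lambda>t. f (Complex \<sigma> t)) sequentially"
    unfolding uniform_limit_sequentially_iff dist_norm
  proof safe
    fix e :: real assume "e > 0"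
    then obtain N where N: "inverse (real (Suc N)) < e" using reals_Archimedean by blast
    have "cmod (exp_sum (S n) (c n) (Complex \<sigma> t) - f (Complex \<sigma> t)) < e" if "n \<ge> N" for n t
    proof -
      have "inverse (real (Suc n)) \<le> inverse (real (Suc N))" using that by (intro le_imp_inverse_le) auto
      then show ?thesis
        using Sc[of t n] N norm_minus_commute[of "f (Complex \<sigma> t)" "exp_sum (S n) (c n) (Complex \<sigma> t)"]
        by linarith
    qed
    then show "\<exists>N. \<forall>n\<ge>N. \<forall>t\<in>A. cmod (exp_sum (S n) (c n) (Complex \<sigma> t) - f (Complex \<sigma> t)) < e" by blast
  qed
  then show ?thesis
    by (rule uniform_limit_theorem[rotated]) (auto intro!: always_eventually allI continuous_on_exp_sum_line)
qed

section \<open>Existence and continuity of Dirichlet coefficients\<close>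

lemma line_mean_norm_le:
  assumes m: "has_mean (\<lambda>t. h (Complex \<sigma> t) * exp (- of_real l * Complex \<sigma> t)) a"
    and cont: "continuous_on UNIV (\<lambda>t. h (Complex \<sigma> t))"
    and B: "\<And>t. cmod (h (Complex \<sigma> t)) \<le> B"
  shows "cmod a \<le> B * exp (- l * \<sigma>)"
proof (rule has_mean_norm_le[OF m])
  show "continuous_on UNIV (\<lambda>t. h (Complex \<sigma> t) * exp (- of_real l * Complex \<sigma> t))"
    using continuous_on_mult[OF cont continuous_on_exp_line[of UNIV "- l"]] by simp
  have "has_mean (\<lambda>t. complex_of_real (B * exp (- l * \<sigma>)) * cis (0 * t)) (complex_of_real (B * exp (- l * \<sigma>)) * 1)"
    using has_mean_cmult[OF has_mean_cis[of 0]] by simp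
  then show "has_mean (\<lambda>t. complex_of_real (B * exp (- l * \<sigma>))) (complex_of_real (B * exp (- l * \<sigma>)))"
    by simp
  show "cmod (h (Complex \<sigma> t) * exp (- of_real l * Complex \<sigma> t)) \<le> B * exp (- l * \<sigma>)" for t
    using B[of t] exp_line[of "- l" \<sigma> t] by (simp add: norm_mult mult_right_mono)
qed simp

text \<open>Exponential polynomials converging uniformly to \<open>f\<close> on the strip have
  coefficients at \<open>l\<close> that form a Cauchy sequence, and the limit is the mean value for
  \<open>f\<close>. One number serves all lines of the strip because the coefficients of the
  approximants do not depend on the line.\<close>

lemma AP_has_mean_strip:
  assumes f: "f \<in> AP \<alpha> \<beta>" and ab: "\<alpha> < ereal \<alpha>1" "\<alpha>1 \<le> \<beta>1" "ereal \<beta>1 < \<beta>"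
  shows "\<exists>a. \<forall>\<sigma>. \<alpha>1 \<le> \<sigma> \<and> \<sigma> \<le> \<beta>1 \<longrightarrow>
    has_mean (\<lambda>t. f (Complex \<sigma> t) * exp (- of_real l * Complex \<sigma> t)) a"
proof -
  have "\<exists>S c. finite S \<and> (\<forall>s. \<alpha>1 \<le> Re s \<and> Re s \<le> \<beta>1 \<longrightarrow> cmod (f s - exp_sum S c s) < inverse (Suc n))" for n
    using AP_approx[OF f ab(1,3), of "inverse (Suc n)"] by (metis inverse_positive_iff_positive
        of_nat_0_less_iff zero_less_Suc)
  then obtain S c where fin: "\<And>n. finite (S n)"
    and Sc: "\<And>n s. \<alpha>1 \<le> Re s \<Longrightarrow> Re s \<le> \<beta>1 \<Longrightarrow> cmod (f s - exp_sum (S n) (c n) s) < inverse (Suc n)"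
    by metis
  define b where "b n = (if l \<in> S n then c n l else 0)" for n
  define C where "C \<sigma> = exp (- l * \<sigma>)" for \<sigma>
  have C: "C \<sigma> > 0" for \<sigma> by (simp add: C_def)
  have mono: "inverse (real (Suc n)) \<le> inverse (real (Suc N))" if "N \<le> n" for n N
    using that by (intro le_imp_inverse_le) auto
  have small: "\<exists>N. inverse (real (Suc N)) * D < e" if "e > 0" "D > 0" for e D :: real
    using reals_Archimedean[of "e / D"] that by (simp add: pos_less_divide_eq)
  have "Cauchy b"
  proof (rule metric_CauchyI)
    fix e :: real assume e: "e > 0"
    \<comment> \<open>Two approximants of index at least \<open>N\<close> differ by at most twice
      \<open>inverse (Suc N)\<close> on the line \<open>\<alpha>1\<close>;
      \<open>C \<alpha>1\<close> is the modulus of \<open>exp (- l * s)\<close> there.\<close>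
    obtain N where N: "inverse (real (Suc N)) * (2 * C \<alpha>1) < e" using small[OF e, of "2 * C \<alpha>1"] C by auto
    have "dist (b m) (b n) < e" if "m \<ge> N" "n \<ge> N" for m n
    proof -
      have "cmod (b m - b n) \<le> (2 * inverse (real (Suc N))) * exp (- l * \<alpha>1)"
      proof (rule line_mean_norm_le)
        show "has_mean (\<lambda>t. (exp_sum (S m) (c m) (Complex \<alpha>1 t) - exp_sum (S n) (c n) (Complex \<alpha>1 t)) *
            exp (- of_real l * Complex \<alpha>1 t)) (b m - b n)"
          unfolding b_def left_diff_distrib using continuous_on_exp_line[of UNIV "- l"]
          by (intro has_mean_diff has_mean_exp_sum fin continuous_on_mult continuous_on_exp_sum_line) auto
        show "continuous_on UNIV (\<lambda>t. exp_sum (S m) (c m) (Complex \<alpha>1 t) - exp_sum (S n) (c n) (Complex \<alpha>1 t))"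
          by (intro continuous_intros continuous_on_exp_sum_line)
        show "cmod (exp_sum (S m) (c m) (Complex \<alpha>1 t) - exp_sum (S n) (c n) (Complex \<alpha>1 t)) \<le> 2 * inverse (real (Suc N))" for t
        proof -
          have "cmod (f (Complex \<alpha>1 t) - exp_sum (S k) (c k) (Complex \<alpha>1 t)) < inverse (real (Suc N))"
            if "k \<ge> N" for k
            using Sc[of "Complex \<alpha>1 t" k] mono[OF that] ab(2) by (simp del: of_nat_Suc inverse_le_iff_le)
          from norm_triangle_ineq4[of "f (Complex \<alpha>1 t) - exp_sum (S n) (c n) (Complex \<alpha>1 t)"
              "f (Complex \<alpha>1 t) - exp_sum (S m) (c m) (Complex \<alpha>1 t)"] this[OF \<open>m \<ge> N\<close>] this[OF \<open>n \<ge> N\<close>]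
          show ?thesis by (simp del: of_nat_Suc)
        qed
      qed
      then show ?thesis using N by (simp add: dist_norm C_def mult_ac)
    qed
    then show "\<exists>N. \<forall>m\<ge>N. \<forall>n\<ge>N. dist (b m) (b n) < e" by blast
  qed
  then obtain a where a: "b \<longlonglongrightarrow> a" using Cauchy_convergent_iff convergent_def by blast
  \<comment> \<open>Three errors below \<open>e / 3\<close>: averages of \<open>f\<close> against
    averages of an approximant, uniformly in \<open>T > 0\<close>; averages of the approximant
    against its coefficient \<open>b n\<close>, for large \<open>T\<close>; and \<open>b n\<close>
    against \<open>a\<close>.\<close>
  have "has_mean (\<lambda>t. f (Complex \<sigma> t) * exp (- of_real l * Complex \<sigma> t)) a" if \<sigma>: "\<alpha>1 \<le> \<sigma>" "\<sigma> \<le> \<beta>1" for \<sigma>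
    unfolding has_mean_def
  proof (rule tendstoI)
    let ?F = "\<lambda>T. integral {-T..T} (\<lambda>t. f (Complex \<sigma> t) * exp (- of_real l * Complex \<sigma> t)) / of_real (2 * T)"
    let ?G = "\<lambda>n T. integral {-T..T} (\<lambda>t. exp_sum (S n) (c n) (Complex \<sigma> t) * exp (- of_real l * Complex \<sigma> t)) / of_real (2 * T)"
    have \<sigma>': "\<alpha> < ereal \<sigma>" "ereal \<sigma> < \<beta>"
      using ab \<sigma> by (meson ereal_less_eq(3) less_le_trans le_less_trans)+
    fix e :: real assume e: "e > 0"
    obtain N where N: "inverse (real (Suc N)) * C \<sigma> < e / 3" using small[of "e / 3" "C \<sigma>"] C e by auto
    have "eventually (\<lambda>n. dist (b n) a < e / 3) sequentially" using a e by (intro tendstoD) auto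
    moreover have "eventually (\<lambda>n. n \<ge> N) sequentially" by (rule eventually_ge_at_top)
    ultimately have "eventually (\<lambda>n. dist (b n) a < e / 3 \<and> n \<ge> N) sequentially"
      by (rule eventually_conj)
    then obtain n where n: "dist (b n) a < e / 3" "n \<ge> N"
      using eventually_happens' sequentially_bot by blast
    have "eventually (\<lambda>T. dist (?G n T) (b n) < e / 3) at_top"
      using has_mean_exp_sum[OF fin[of n], of "c n" \<sigma> l] e unfolding has_mean_def b_def by (intro tendstoD) auto
    then show "eventually (\<lambda>T. dist (?F T) a < e) at_top" using eventually_gt_at_top[of 0]
    proof eventually_elim
      case (elim T)
      have int: "(\<lambda>t. f (Complex \<sigma> t) * exp (- of_real l * Complex \<sigma> t)) integrable_on {-T..T}"
        "(\<lambda>t. exp_sum (S n) (c n) (Complex \<sigma> t) * exp (- of_real l * Complex \<sigma> t)) integrable_on {-T..T}"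
        using continuous_on_exp_line[of "{-T..T}" "- l"] AP_continuous_line[OF f \<sigma>']
        by (auto intro!: integrable_continuous_interval continuous_on_mult continuous_on_exp_sum_line)
      have "cmod (integral {-T..T} (\<lambda>t. f (Complex \<sigma> t) * exp (- of_real l * Complex \<sigma> t)) -
          integral {-T..T} (\<lambda>t. exp_sum (S n) (c n) (Complex \<sigma> t) * exp (- of_real l * Complex \<sigma> t)))
         \<le> (inverse (real (Suc N)) * C \<sigma>) * (T - (- T))"
        unfolding integral_diff[OF int, symmetric]
      proof (rule integral_bound)
        show "continuous_on {-T..T} (\<lambda>t. f (Complex \<sigma> t) * exp (- of_real l * Complex \<sigma> t) -
            exp_sum (S n) (c n) (Complex \<sigma> t) * exp (- of_real l * Complex \<sigma> t))"
          using continuous_on_exp_line[of "{-T..T}" "- l"] AP_continuous_line[OF f \<sigma>']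
          by (auto intro!: continuous_on_diff continuous_on_mult continuous_on_exp_sum_line)
        fix t
        have "cmod (f (Complex \<sigma> t) - exp_sum (S n) (c n) (Complex \<sigma> t)) * C \<sigma> \<le> inverse (real (Suc N)) * C \<sigma>"
          using Sc[of "Complex \<sigma> t" n] \<sigma> mono[OF n(2)] C[of \<sigma>]
          by (intro mult_right_mono) (simp_all del: of_nat_Suc inverse_le_iff_le)
        then show "cmod (f (Complex \<sigma> t) * exp (- of_real l * Complex \<sigma> t) -
            exp_sum (S n) (c n) (Complex \<sigma> t) * exp (- of_real l * Complex \<sigma> t)) \<le> inverse (real (Suc N)) * C \<sigma>"
          using exp_line[of "- l" \<sigma> t] by (simp add: norm_mult C_def left_diff_distrib[symmetric])
      qed (use elim in auto)
      then have "cmod (?F T - ?G n T) \<le> inverse (real (Suc N)) * C \<sigma>"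
        using elim by (simp add: diff_divide_distrib[symmetric] norm_divide norm_mult divide_le_eq)
      then have "dist (?F T) (?G n T) < e / 3" using N by (simp add: dist_norm)
      then show ?case
        using elim n(1) dist_triangle[of "?F T" a "?G n T"] dist_triangle[of "?G n T" a "b n"] by linarith
    qed
  qed
  then show ?thesis by blast
qed

text \<open>Any two lines lie in a common closed substrip, on which the mean value is constant.
  Hence the number described in \<open>dirichlet_coeff\<close> exists and is unique as soon as the
  strip contains a line.\<close>

lemma dirichlet_coeff_has_mean:
  assumes f: "f \<in> AP \<alpha> \<beta>" and \<sigma>: "\<alpha> < ereal \<sigma>" "ereal \<sigma> < \<beta>"
  shows "has_mean (\<lambda>t. f (Complex \<sigma> t) * exp (- of_real l * Complex \<sigma> t)) (dirichlet_coeff \<alpha> \<beta> f l)"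
proof -
  let ?h = "\<lambda>\<sigma> t. f (Complex \<sigma> t) * exp (- of_real l * Complex \<sigma> t)"
  obtain a where a: "has_mean (?h \<sigma>) a"
    using AP_has_mean_strip[OF f \<sigma>(1) order_refl \<sigma>(2)] by blast
  have all: "has_mean (?h \<sigma>') a" if \<sigma>': "\<alpha> < ereal \<sigma>'" "ereal \<sigma>' < \<beta>" for \<sigma>'
  proof -
    have "\<alpha> < ereal (min \<sigma> \<sigma>')" "ereal (max \<sigma> \<sigma>') < \<beta>"
      using \<sigma> \<sigma>' by (auto simp: min_def max_def)
    then obtain a' where a': "\<And>\<tau>. min \<sigma> \<sigma>' \<le> \<tau> \<Longrightarrow> \<tau> \<le> max \<sigma> \<sigma>' \<Longrightarrow> has_mean (?h \<tau>) a'"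
      using AP_has_mean_strip[OF f, of "min \<sigma> \<sigma>'" "max \<sigma> \<sigma>'"] by fastforce
    have "a' = a" using has_mean_unique[OF a'[of \<sigma>] a] by simp
    with a'[of \<sigma>'] show ?thesis by simp
  qed
  have "dirichlet_coeff \<alpha> \<beta> f l = a"
    unfolding dirichlet_coeff_def has_mean_def[symmetric]
  proof (rule the_equality)
    show "\<forall>\<sigma>'. \<alpha> < ereal \<sigma>' \<and> ereal \<sigma>' < \<beta> \<longrightarrow> has_mean (?h \<sigma>') a" using all by blast
    show "b = a" if "\<forall>\<sigma>'. \<alpha> < ereal \<sigma>' \<and> ereal \<sigma>' < \<beta> \<longrightarrow> has_mean (?h \<sigma>') b" for b
      using has_mean_unique[OF _ a] that \<sigma> by blast
  qed
  then show ?thesis using a by simp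
qed

lemma dirichlet_coeff_diff:
  assumes "\<alpha> < \<beta>" "f \<in> AP \<alpha> \<beta>" "h \<in> AP \<alpha> \<beta>"
  shows "dirichlet_coeff \<alpha> \<beta> (\<lambda>s. f s - h s) l = dirichlet_coeff \<alpha> \<beta> f l - dirichlet_coeff \<alpha> \<beta> h l"
proof -
  obtain \<sigma> where \<sigma>: "\<alpha> < ereal \<sigma>" "ereal \<sigma> < \<beta>" using ereal_dense2[OF assms(1)] by blast
  have cont: "continuous_on UNIV (\<lambda>t. exp (- of_real l * Complex \<sigma> t))"
    using continuous_on_exp_line[of UNIV "- l"] by simp
  have "has_mean (\<lambda>t. (f (Complex \<sigma> t) - h (Complex \<sigma> t)) * exp (- of_real l * Complex \<sigma> t))
      (dirichlet_coeff \<alpha> \<beta> f l - dirichlet_coeff \<alpha> \<beta> h l)"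
    unfolding left_diff_distrib
    by (intro has_mean_diff dirichlet_coeff_has_mean continuous_on_mult cont
        AP_continuous_line[OF assms(2) \<sigma>] AP_continuous_line[OF assms(3) \<sigma>] assms \<sigma>)
  then show ?thesis
    using has_mean_unique[OF dirichlet_coeff_has_mean[OF AP_diff[OF assms(2,3)] \<sigma>]] by blast
qed

lemma dirichlet_coeff_exp_sum:
  assumes "\<alpha> < \<beta>" "finite S"
  shows "dirichlet_coeff \<alpha> \<beta> (exp_sum S c) l = (if l \<in> S then c l else 0)"
proof -
  obtain \<sigma> where \<sigma>: "\<alpha> < ereal \<sigma>" "ereal \<sigma> < \<beta>" using ereal_dense2[OF assms(1)] by blast
  show ?thesis
    using has_mean_unique[OF dirichlet_coeff_has_mean[OF exp_sum_AP[OF assms(2)] \<sigma>] has_mean_exp_sum[OF assms(2)]] .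
qed

lemma dirichlet_coeff_norm_le:
  assumes "f \<in> AP \<alpha> \<beta>" "\<alpha> < ereal \<sigma>" "ereal \<sigma> < \<beta>" "\<And>t. cmod (f (Complex \<sigma> t)) \<le> B"
  shows "cmod (dirichlet_coeff \<alpha> \<beta> f l) \<le> B * exp (- l * \<sigma>)"
  by (rule line_mean_norm_le[OF dirichlet_coeff_has_mean AP_continuous_line]) (use assms in auto)

subsection \<open>Twisted Bochner-Fejer sums\<close>

text \<open>The coefficient at \<open>l\<close> is bounded by \<open>exp (- l * \<sigma>)\<close>
  times the supremum on the line, so uniform convergence on one line is enough.\<close>

lemma dirichlet_coeff_uniform_limit:
  assumes \<sigma>: "\<alpha> < ereal \<sigma>" "ereal \<sigma> < \<beta>"
    and AP: "\<And>k. P k \<in> AP \<alpha> \<beta>" "f \<in> AP \<alpha> \<beta>"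
    and lim: "uniform_limit X P f sequentially" "{s. Re s = \<sigma>} \<subseteq> X"
  shows "(\<lambda>k. dirichlet_coeff \<alpha> \<beta> (P k) l) \<longlonglongrightarrow> dirichlet_coeff \<alpha> \<beta> f l"
proof (rule LIMSEQ_I)
  fix e :: real assume e: "e > 0"
  have ab: "\<alpha> < \<beta>" using \<sigma> by (rule less_trans)
  define d where "d = e / (2 * exp (- l * \<sigma>))"
  have d: "d > 0" using e by (simp add: d_def)
  then obtain K where K: "\<And>k s. k \<ge> K \<Longrightarrow> s \<in> X \<Longrightarrow> dist (P k s) (f s) < d"
    using lim(1) unfolding uniform_limit_sequentially_iff by blast
  have "norm (dirichlet_coeff \<alpha> \<beta> (P k) l - dirichlet_coeff \<alpha> \<beta> f l) < e" if "k \<ge> K" for k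
  proof -
    have "cmod (dirichlet_coeff \<alpha> \<beta> (\<lambda>s. P k s - f s) l) \<le> d * exp (- l * \<sigma>)"
    proof (rule dirichlet_coeff_norm_le[OF AP_diff[OF AP] \<sigma>])
      fix t
      have "Complex \<sigma> t \<in> X" using lim(2) by auto
      then show "cmod (P k (Complex \<sigma> t) - f (Complex \<sigma> t)) \<le> d"
        using K[OF that] by (auto simp: dist_norm intro: less_imp_le)
    qed
    then show ?thesis using e unfolding dirichlet_coeff_diff[OF ab AP] by (simp add: d_def)
  qed
  then show "\<exists>K. \<forall>k\<ge>K. norm (dirichlet_coeff \<alpha> \<beta> (P k) l - dirichlet_coeff \<alpha> \<beta> f l) < e" by blast
qed

text \<open>The strict bound by \<open>fact k\<close> keeps every factor of the product positive, so
  the exponents with nonzero factor are exactly those whose coordinates lie in a box.\<close>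

lemma bochner_fejer_factor_nonzero:
  "bochner_fejer_factor k r \<noteq> 0 \<longleftrightarrow> (\<forall>m\<ge>k. r m = 0) \<and> (\<forall>m<k. \<bar>r m\<bar> < fact k)"
proof -
  have "1 - real_of_int \<bar>r m\<bar> / fact k \<noteq> 0" if "\<bar>r m\<bar> < fact k" for m
  proof -
    have "real_of_int \<bar>r m\<bar> < real_of_int (fact k)" using that by (simp only: of_int_less_iff)
    then show ?thesis by simp
  qed
  then show ?thesis by (auto simp: bochner_fejer_factor_def)
qed

text \<open>Once \<open>k\<close> exceeds the finite support of \<open>r\<close> and
  \<open>fact k\<close> exceeds its entries, the product runs over this support, with each factor
  tending to 1.\<close>

lemma bochner_fejer_factor_tendsto:
  assumes "finite {m. r m \<noteq> 0}"
  shows "(\<lambda>k. bochner_fejer_factor k r) \<longlonglongrightarrow> 1"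
proof -
  let ?A = "{m. r m \<noteq> 0}"
  have fact: "filterlim (\<lambda>k. fact k :: real) at_top sequentially"
  proof (rule filterlim_at_top_mono[OF filterlim_real_sequentially])
    have "real k \<le> real (fact k)" for k by (simp only: of_nat_le_iff fact_ge_self)
    then show "eventually (\<lambda>k. real k \<le> fact k) sequentially" by simp
  qed
  have "(\<lambda>k. \<Prod>m\<in>?A. 1 - real_of_int \<bar>r m\<bar> / fact k) \<longlonglongrightarrow> (\<Prod>m\<in>?A. 1 - 0)"
    by (intro tendsto_prod tendsto_diff tendsto_const tendsto_divide_0[OF tendsto_const]
        filterlim_at_top_imp_at_infinity fact)
  moreover have "eventually (\<lambda>k. \<forall>m\<in>?A. m < k \<and> real_of_int \<bar>r m\<bar> < fact k) sequentially"
    using assms fact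
    by (intro eventually_ball_finite ballI eventually_conj eventually_gt_at_top)
       (auto simp: filterlim_at_top_dense)
  then have "eventually (\<lambda>k. (\<Prod>m\<in>?A. 1 - real_of_int \<bar>r m\<bar> / fact k) = bochner_fejer_factor k r) sequentially"
  proof eventually_elim
    case (elim k)
    have 1: "\<forall>m\<ge>k. r m = 0" using elim by force
    have "\<bar>r m\<bar> < fact k" for m
    proof (cases "r m = 0")
      case False
      then have "real_of_int \<bar>r m\<bar> < real_of_int (fact k)" using elim by simp
      then show ?thesis by (simp only: of_int_less_iff)
    qed simp
    then have "bochner_fejer_factor k r = (\<Prod>m<k. 1 - real_of_int \<bar>r m\<bar> / fact k)"
      using 1 by (simp add: bochner_fejer_factor_def)
    also have "\<dots> = (\<Prod>m\<in>?A. 1 - real_of_int \<bar>r m\<bar> / fact k)"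
      using elim by (intro prod.mono_neutral_right) auto
    finally show ?case ..
  qed
  ultimately show ?thesis by (simp add: tendsto_cong)
qed

section \<open>Integer independence, coordinates and Bochner-Fejer sums\<close>

lemma rat_independent_imp_int_independent:
  assumes inj: "inj_on g A" and indep: "rat_vs.independent (g ` A)"
    and I: "finite I" "I \<subseteq> A" and sum: "(\<Sum>m\<in>I. of_int (r m) * g m) = 0" and m: "m \<in> I"
  shows "r m = (0::int)"
proof -
  have inj: "inj_on g I" using inj I(2) by (rule inj_on_subset)
  define u where "u v = (of_int (r (the_inv_into I g v)) :: rat)" for v
  have "(\<Sum>v\<in>g ` I. rat_scale (u v) v) = (\<Sum>m\<in>I. of_int (r m) * g m)"
    using inj by (simp add: sum.reindex u_def the_inv_into_f_f rat_scale_def)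
  then have "(\<Sum>v\<in>g ` I. rat_scale (u v) v) = 0" using sum by simp
  moreover have "g ` I \<subseteq> g ` A" "finite (g ` I)" using I by auto
  ultimately have "\<forall>v\<in>g ` I. u v = 0"
    using indep unfolding rat_vs.independent_explicit_finite_subsets by blast
  then have "u (g m) = 0" using m by blast
  then show ?thesis using inj m by (simp add: u_def the_inv_into_f_f)
qed

text \<open>Retains only the independence in an integral basis, without reference to
  \<open>\<Lambda>\<close>. The Bochner-Fejer theory can thus also be applied to a family made for a
  finite set of exponents, as the uniqueness theorem requires.\<close>

locale int_independent_family =
  fixes N :: enat and g :: "nat \<Rightarrow> real"
  assumes int_independent: "\<lbrakk>finite I; I \<subseteq> basis_index N; (\<Sum>m\<in>I. of_int (r m) * g m) = 0; m \<in> I\<rbrakk>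
    \<Longrightarrow> r m = (0::int)"
begin

lemma is_int_coords_unique:
  assumes "is_int_coords N g l r" "is_int_coords N g l r'"
  shows "r = r'"
proof
  fix m
  let ?I = "{k. r k \<noteq> 0} \<union> {k. r' k \<noteq> 0}"
  have I: "finite ?I" "?I \<subseteq> basis_index N" using assms by (auto simp: is_int_coords_def)
  have "(\<Sum>m | r m \<noteq> 0. of_int (r m) * g m) = (\<Sum>m\<in>?I. of_int (r m) * g m)"
    "(\<Sum>m | r' m \<noteq> 0. of_int (r' m) * g m) = (\<Sum>m\<in>?I. of_int (r' m) * g m)"
    using I(1) by (intro sum.mono_neutral_left; auto)+
  then have "l = (\<Sum>m\<in>?I. of_int (r m) * g m)" "l = (\<Sum>m\<in>?I. of_int (r' m) * g m)"
    using assms unfolding is_int_coords_def by metis+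
  then have "(\<Sum>m\<in>?I. of_int (r m - r' m) * g m) = 0"
    by (simp add: left_diff_distrib sum_subtractf)
  then have "r m - r' m = 0" if "m \<in> ?I" using int_independent[OF I, of "\<lambda>m. r m - r' m"] that by blast
  then show "r m = r' m" by (cases "m \<in> ?I") auto
qed

lemma int_coords_eq: "is_int_coords N g l r \<Longrightarrow> int_coords N g l = r"
  unfolding int_coords_def by (rule the_equality) (auto intro: is_int_coords_unique)

text \<open>The additive group generated by the family. Outside it no integer coordinates exist, and
  \<open>int_coords\<close> is an unspecified value there.\<close>

definition lattice :: "real set" where
  "lattice = {l. \<exists>r. is_int_coords N g l r}"

definition phase :: "(nat \<Rightarrow> real) \<Rightarrow> real \<Rightarrow> real" where
  "phase x l = (\<Sum>m | int_coords N g l m \<noteq> 0. of_int (int_coords N g l m) * x m)"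

text \<open>Taken in the whole lattice rather than in \<open>\<Lambda>\<close>, so that these
  exponents fill a complete box of coordinate vectors, as in the expansion of a product of Fejer
  kernels.\<close>

definition bf_exponents :: "nat \<Rightarrow> real set" where
  "bf_exponents k = {l \<in> lattice. bochner_fejer_factor k (int_coords N g l) \<noteq> 0}"

definition bf_sum :: "nat \<Rightarrow> (real \<Rightarrow> complex) \<Rightarrow> (nat \<Rightarrow> real) \<Rightarrow> complex \<Rightarrow> complex" where
  "bf_sum k a x = exp_sum (bf_exponents k)
     (\<lambda>l. of_real (bochner_fejer_factor k (int_coords N g l)) * a l * cis (phase x l))"

lemma int_coords_lattice: "l \<in> lattice \<Longrightarrow> is_int_coords N g l (int_coords N g l)"
  using int_coords_eq by (auto simp: lattice_def)

section \<open>The exponents of order \<open>k\<close> as a box of coordinate vectors\<close>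

definition bf_index :: "nat \<Rightarrow> nat set" where
  "bf_index k = {m \<in> basis_index N. m < k}"

definition bf_box :: "nat \<Rightarrow> (nat \<Rightarrow> int) set" where
  "bf_box k = bf_index k \<rightarrow>\<^sub>E {- fact k<..<fact k}"

definition bf_point :: "nat \<Rightarrow> (nat \<Rightarrow> int) \<Rightarrow> real" where
  "bf_point k r = (\<Sum>m\<in>bf_index k. of_int (r m) * g m)"

lemma bf_index_subset: "bf_index k \<subseteq> basis_index N"
  by (auto simp: bf_index_def)

lemma finite_bf_index: "finite (bf_index k)"
  by (simp add: bf_index_def)

lemma finite_bf_box: "finite (bf_box k)"
  unfolding bf_box_def by (intro finite_PiE finite_bf_index) auto

text \<open>Extending a vector of the box by 0 yields the coordinates of its exponent; the indices
  below \<open>k\<close> outside the basis contribute factors 1 to the Bochner-Fejer factor.\<close>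

lemma bf_point:
  assumes "r \<in> bf_box k"
  defines "r' \<equiv> \<lambda>m. if m \<in> bf_index k then r m else 0"
  shows "is_int_coords N g (bf_point k r) r'" "int_coords N g (bf_point k r) = r'"
    "bf_point k r \<in> bf_exponents k"
    "bochner_fejer_factor k r' = (\<Prod>m\<in>bf_index k. 1 - of_int \<bar>r m\<bar> / fact k)"
proof -
  have r': "\<bar>r' m\<bar> < fact k" "m \<notin> bf_index k \<Longrightarrow> r' m = 0" for m
  proof -
    have "r m \<in> {- fact k<..<fact k}" if "m \<in> bf_index k"
      using assms(1) that unfolding bf_box_def by (rule PiE_mem)
    then show "\<bar>r' m\<bar> < fact k" by (cases "m \<in> bf_index k") (auto simp: r'_def abs_less_iff)
  qed (simp add: r'_def)
  have "{m. r' m \<noteq> 0} \<subseteq> bf_index k" using r'(2) by blast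
  moreover have "bf_point k r = (\<Sum>m | r' m \<noteq> 0. of_int (r' m) * g m)"
    unfolding bf_point_def by (rule sum.mono_neutral_cong_right) (auto simp: r'_def finite_bf_index)
  ultimately show *: "is_int_coords N g (bf_point k r) r'"
    unfolding is_int_coords_def using finite_subset[OF _ finite_bf_index[of k]]
    by (meson bf_index_subset subset_trans)
  then show **: "int_coords N g (bf_point k r) = r'" by (rule int_coords_eq)
  have nz: "(\<forall>m\<ge>k. r' m = 0) \<and> (\<forall>m<k. \<bar>r' m\<bar> < fact k)"
    using r' unfolding bf_index_def by (metis (no_types, lifting) mem_Collect_eq not_le)
  then show "bf_point k r \<in> bf_exponents k"
    unfolding bf_exponents_def lattice_def mem_Collect_eq ** bochner_fejer_factor_nonzero using * by blast
  have "bochner_fejer_factor k r' = (\<Prod>m<k. 1 - of_int \<bar>r' m\<bar> / fact k)"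
    using nz by (simp add: bochner_fejer_factor_def)
  also have "\<dots> = (\<Prod>m\<in>bf_index k. 1 - of_int \<bar>r m\<bar> / fact k)"
    by (rule prod.mono_neutral_cong_right) (auto simp: r'_def bf_index_def)
  finally show "bochner_fejer_factor k r' = (\<Prod>m\<in>bf_index k. 1 - of_int \<bar>r m\<bar> / fact k)" .
qed

lemma bf_exponents_coords:
  assumes "l \<in> bf_exponents k"
  shows "restrict (int_coords N g l) (bf_index k) \<in> bf_box k"
    "bf_point k (restrict (int_coords N g l) (bf_index k)) = l"
proof -
  define r where "r = int_coords N g l"
  have r: "\<forall>m\<ge>k. r m = 0" "\<forall>m<k. \<bar>r m\<bar> < fact k" "is_int_coords N g l r"
    using assms bochner_fejer_factor_nonzero int_coords_lattice unfolding bf_exponents_def r_def by blast+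
  have "r m \<in> {- fact k<..<fact k}" if "m \<in> bf_index k" for m
    using r(2) that by (auto simp: bf_index_def abs_less_iff)
  then show "restrict (int_coords N g l) (bf_index k) \<in> bf_box k"
    unfolding bf_box_def r_def[symmetric] by (simp add: restrict_PiE_iff)
  have sub: "{m. r m \<noteq> 0} \<subseteq> bf_index k"
  proof
    fix m assume m: "m \<in> {m. r m \<noteq> 0}"
    then have "m < k" using r(1) by (cases "m < k") auto
    then show "m \<in> bf_index k" using r(3) m unfolding is_int_coords_def bf_index_def by blast
  qed
  have "bf_point k (restrict r (bf_index k)) = (\<Sum>m\<in>bf_index k. of_int (r m) * g m)"
    unfolding bf_point_def by (intro sum.cong) auto
  also have "\<dots> = (\<Sum>m | r m \<noteq> 0. of_int (r m) * g m)"
    by (rule sum.mono_neutral_right[OF finite_bf_index sub]) auto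
  also have "\<dots> = l" using r(3) unfolding is_int_coords_def by (elim conjE) (rule sym)
  finally show "bf_point k (restrict (int_coords N g l) (bf_index k)) = l" unfolding r_def .
qed

lemma bij_betw_bf_point: "bij_betw (bf_point k) (bf_box k) (bf_exponents k)"
proof (rule bij_betw_byWitness[where f' = "\<lambda>l. restrict (int_coords N g l) (bf_index k)"])
  show "\<forall>r\<in>bf_box k. restrict (int_coords N g (bf_point k r)) (bf_index k) = r"
  proof
    fix r assume r: "r \<in> bf_box k"
    show "restrict (int_coords N g (bf_point k r)) (bf_index k) = r"
      unfolding bf_point(2)[OF r]
      by (rule extensionalityI[of _ "bf_index k"]) (use r in \<open>auto simp: bf_box_def PiE_def\<close>)
  qed
  show "\<forall>l\<in>bf_exponents k. bf_point k (restrict (int_coords N g l) (bf_index k)) = l"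
    using bf_exponents_coords(2) by blast
  show "bf_point k ` bf_box k \<subseteq> bf_exponents k"
    using bf_point(3) by blast
  show "(\<lambda>l. restrict (int_coords N g l) (bf_index k)) ` bf_exponents k \<subseteq> bf_box k"
    using bf_exponents_coords(1) by blast
qed

lemma finite_bf_exponents: "finite (bf_exponents k)"
  using bij_betw_finite[OF bij_betw_bf_point] finite_bf_box by blast

text \<open>Brings the sum into the form estimated by \<open>fejer_contraction\<close>, with
  \<open>n\<close> equal to \<open>fact k\<close>.\<close>

lemma bf_sum_box:
  "bf_sum k a x s = (\<Sum>r\<in>bf_box k. of_real (\<Prod>m\<in>bf_index k. 1 - of_int \<bar>r m\<bar> / fact k) *
     (a (bf_point k r) * exp (of_real (bf_point k r) * s)) * cis (\<Sum>m\<in>bf_index k. of_int (r m) * x m))"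
  unfolding bf_sum_def exp_sum_def sum.reindex_bij_betw[OF bij_betw_bf_point, symmetric]
proof (intro sum.cong refl)
  fix r assume r: "r \<in> bf_box k"
  have "phase x (bf_point k r) = (\<Sum>m\<in>bf_index k. of_int (r m) * x m)"
    unfolding phase_def bf_point(2)[OF r]
    by (rule sum.mono_neutral_cong_left) (auto simp: finite_bf_index)
  then show "of_real (bochner_fejer_factor k (int_coords N g (bf_point k r))) * a (bf_point k r) *
      cis (phase x (bf_point k r)) * exp (of_real (bf_point k r) * s) =
    of_real (\<Prod>m\<in>bf_index k. 1 - of_int \<bar>r m\<bar> / fact k) *
     (a (bf_point k r) * exp (of_real (bf_point k r) * s)) * cis (\<Sum>m\<in>bf_index k. of_int (r m) * x m)"
    unfolding bf_point(2)[OF r] bf_point(4)[OF r] by simp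
qed

text \<open>A shift by \<open>t\<close> multiplies the term of exponent \<open>l\<close> by
  \<open>cis (l * t)\<close>, and \<open>l * t\<close> is the pairing of the coordinates of
  \<open>l\<close> with \<open>t * g m\<close>.\<close>

lemma bf_sum_translate: "bf_sum k a x (Complex \<sigma> t) = bf_sum k a (\<lambda>m. x m + t * g m) (Complex \<sigma> 0)"
  unfolding bf_sum_box exp_line
proof (intro sum.cong refl)
  fix r
  have "(\<Sum>m\<in>bf_index k. of_int (r m) * (x m + t * g m)) =
      (\<Sum>m\<in>bf_index k. of_int (r m) * x m) + bf_point k r * t"
    by (simp add: bf_point_def distrib_left sum.distrib sum_distrib_left sum_distrib_right mult_ac)
  then have "cis (\<Sum>m\<in>bf_index k. of_int (r m) * (x m + t * g m)) =
      cis (\<Sum>m\<in>bf_index k. of_int (r m) * x m) * cis (bf_point k r * t)"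
    by (simp add: cis_mult)
  then show "of_real (\<Prod>m\<in>bf_index k. 1 - of_int \<bar>r m\<bar> / fact k) *
      (a (bf_point k r) * (of_real (exp (bf_point k r * \<sigma>)) * cis (bf_point k r * t))) *
      cis (\<Sum>m\<in>bf_index k. of_int (r m) * x m) =
    of_real (\<Prod>m\<in>bf_index k. 1 - of_int \<bar>r m\<bar> / fact k) *
      (a (bf_point k r) * (of_real (exp (bf_point k r * \<sigma>)) * cis (bf_point k r * 0))) *
      cis (\<Sum>m\<in>bf_index k. of_int (r m) * (x m + t * g m))"
    by (simp add: mult_ac)
qed

text \<open>The decisive estimate, uniform in \<open>k\<close> and \<open>x\<close>: the imaginary
  part of \<open>s\<close> is absorbed into the rotation, and the Fejer contraction is applied to
  \<open>f\<close> on the line.\<close>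

lemma bf_sum_norm_le:
  assumes f: "f \<in> AP \<alpha> \<beta>" and \<sigma>: "\<alpha> < ereal (Re s)" "ereal (Re s) < \<beta>"
    and B: "\<And>t. cmod (f (Complex (Re s) t)) \<le> B"
  shows "cmod (bf_sum k (dirichlet_coeff \<alpha> \<beta> f) x s) \<le> B"
proof -
  define \<sigma> where "\<sigma> = Re s"
  define y where "y m = x m + Im s * g m" for m
  \<comment> \<open>The Fourier coefficient of the restriction of \<open>f\<close> to the line; it
    differs from the Dirichlet coefficient by the modulus of \<open>exp (\<nu> * s)\<close>.\<close>
  define H where "H \<nu> = dirichlet_coeff \<alpha> \<beta> f \<nu> * of_real (exp (\<nu> * \<sigma>))" for \<nu>
  have "bf_sum k (dirichlet_coeff \<alpha> \<beta> f) x s = bf_sum k (dirichlet_coeff \<alpha> \<beta> f) y (Complex \<sigma> 0)"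
    using bf_sum_translate[of k _ x \<sigma> "Im s"] unfolding y_def \<sigma>_def by simp
  also have "\<dots> = (\<Sum>r\<in>bf_box k. of_real (\<Prod>m\<in>bf_index k. 1 - of_int \<bar>r m\<bar> / fact k) *
      H (bf_point k r) * cis (\<Sum>m\<in>bf_index k. of_int (r m) * y m))"
    unfolding bf_sum_box H_def exp_line by (simp add: mult_ac)
  finally have eq: "bf_sum k (dirichlet_coeff \<alpha> \<beta> f) x s = \<dots>" .
  have H: "has_mean (\<lambda>u. f (Complex \<sigma> u) * cis (- \<nu> * u)) (H \<nu>)" for \<nu>
  proof -
    have e: "exp (- of_real \<nu> * Complex \<sigma> u) = of_real (exp (- \<nu> * \<sigma>)) * cis (- \<nu> * u)" for u
      using exp_line[of "- \<nu>" \<sigma> u] by simp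
    have "has_mean (\<lambda>u. of_real (exp (\<nu> * \<sigma>)) * (f (Complex \<sigma> u) * exp (- of_real \<nu> * Complex \<sigma> u)))
        (of_real (exp (\<nu> * \<sigma>)) * dirichlet_coeff \<alpha> \<beta> f \<nu>)"
      using \<sigma> by (intro has_mean_cmult dirichlet_coeff_has_mean f) (auto simp: \<sigma>_def)
    also have "(\<lambda>u. of_real (exp (\<nu> * \<sigma>)) * (f (Complex \<sigma> u) * exp (- of_real \<nu> * Complex \<sigma> u))) =
        (\<lambda>u. f (Complex \<sigma> u) * cis (- \<nu> * u))"
    proof
      fix u
      have "of_real (exp (\<nu> * \<sigma>)) * (f (Complex \<sigma> u) * exp (- of_real \<nu> * Complex \<sigma> u)) =
          of_real (exp (\<nu> * \<sigma>) * exp (- \<nu> * \<sigma>)) * (f (Complex \<sigma> u) * cis (- \<nu> * u))"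
        unfolding e of_real_mult by (simp only: mult_ac)
      also have "exp (\<nu> * \<sigma>) * exp (- \<nu> * \<sigma>) = 1"
        unfolding exp_add[symmetric] by simp
      finally show "of_real (exp (\<nu> * \<sigma>)) * (f (Complex \<sigma> u) * exp (- of_real \<nu> * Complex \<sigma> u)) =
          f (Complex \<sigma> u) * cis (- \<nu> * u)" by simp
    qed
    finally show ?thesis by (simp add: H_def mult.commute)
  qed
  have "cmod (\<Sum>r\<in>bf_index k \<rightarrow>\<^sub>E {- int (fact k)<..<int (fact k)}.
      of_real (\<Prod>m\<in>bf_index k. 1 - of_int \<bar>r m\<bar> / real (fact k)) *
      H (\<Sum>m\<in>bf_index k. of_int (r m) * g m) * cis (\<Sum>m\<in>bf_index k. of_int (r m) * y m)) \<le> B"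
  proof (rule fejer_contraction[where h = "\<lambda>u. f (Complex \<sigma> u)" and H = H])
    show "\<And>r m. (\<Sum>m\<in>bf_index k. of_int (r m) * g m) = 0 \<Longrightarrow> m \<in> bf_index k \<Longrightarrow> r m = (0::int)"
      by (rule int_independent[OF finite_bf_index bf_index_subset])
    show "continuous_on UNIV (\<lambda>u. f (Complex \<sigma> u))"
      using \<sigma> unfolding \<sigma>_def by (rule AP_continuous_line[OF f])
  qed (use B H in \<open>auto simp: \<sigma>_def finite_bf_index\<close>)
  then show ?thesis unfolding eq bf_box_def bf_point_def by simp
qed

lemma bf_sum_diff: "bf_sum k a x s - bf_sum k b x s = bf_sum k (\<lambda>l. a l - b l) x s"
  by (simp add: bf_sum_def exp_sum_def sum_subtractf algebra_simps)

text \<open>The index set on the right does not depend on \<open>k\<close>, so the limit can be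
  taken term by term.\<close>

lemma bf_sum_finite_support:
  assumes "finite S" "\<And>l. l \<notin> S \<Longrightarrow> a l = 0"
  shows "bf_sum k a x s = (\<Sum>l\<in>S \<inter> lattice.
    of_real (bochner_fejer_factor k (int_coords N g l)) * (a l * cis (phase x l) * exp (of_real l * s)))"
proof -
  have "bf_sum k a x s = (\<Sum>l\<in>bf_exponents k \<inter> S.
    of_real (bochner_fejer_factor k (int_coords N g l)) * (a l * cis (phase x l) * exp (of_real l * s)))"
    unfolding bf_sum_def exp_sum_def
    by (rule sum.mono_neutral_cong_right) (use assms in \<open>auto simp: finite_bf_exponents mult_ac\<close>)
  also have "\<dots> = (\<Sum>l\<in>S \<inter> lattice.
    of_real (bochner_fejer_factor k (int_coords N g l)) * (a l * cis (phase x l) * exp (of_real l * s)))"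
    by (rule sum.mono_neutral_left) (use assms in \<open>auto simp: bf_exponents_def\<close>)
  finally show ?thesis .
qed

text \<open>Each of finitely many factors tends to 1, and the exponentials they multiply are bounded
  on the strip because its width is finite.\<close>

lemma bf_sum_finite_support_uniform_limit:
  fixes \<alpha>1 \<beta>1 :: real
  assumes S: "finite S" "\<And>l. l \<notin> S \<Longrightarrow> a l = 0"
  shows "uniform_limit {s. \<alpha>1 \<le> Re s \<and> Re s \<le> \<beta>1} (\<lambda>k. bf_sum k a x)
    (exp_sum (S \<inter> lattice) (\<lambda>l. a l * cis (phase x l))) sequentially"
proof -
  let ?X = "{s. \<alpha>1 \<le> Re s \<and> Re s \<le> \<beta>1}"
  have "uniform_limit ?X (\<lambda>k s. \<Sum>l\<in>A. of_real (bochner_fejer_factor k (int_coords N g l)) *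
      (a l * cis (phase x l) * exp (of_real l * s)))
    (\<lambda>s. \<Sum>l\<in>A. a l * cis (phase x l) * exp (of_real l * s)) sequentially"
    if "finite A" "A \<subseteq> lattice" for A
    using that
  proof (induction A)
    case (insert l A)
    have "(\<lambda>k. complex_of_real (bochner_fejer_factor k (int_coords N g l))) \<longlonglongrightarrow> of_real 1"
      by (intro tendsto_of_real bochner_fejer_factor_tendsto)
         (use insert.prems int_coords_lattice in \<open>auto simp: is_int_coords_def\<close>)
    then have lim: "uniform_limit ?X (\<lambda>k s. complex_of_real (bochner_fejer_factor k (int_coords N g l))) (\<lambda>s. 1) sequentially"
      unfolding tendsto_iff uniform_limit_iff by (auto elim!: eventually_mono)
    have "cmod (a l * cis (phase x l) * exp (of_real l * s)) \<le> cmod (a l) * exp (\<bar>l\<bar> * max \<bar>\<alpha>1\<bar> \<bar>\<beta>1\<bar>)"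
      if "s \<in> ?X" for s
    proof -
      have "l * Re s \<le> \<bar>l\<bar> * \<bar>Re s\<bar>" by (metis abs_ge_self abs_mult)
      also have "\<dots> \<le> \<bar>l\<bar> * max \<bar>\<alpha>1\<bar> \<bar>\<beta>1\<bar>" using that by (intro mult_left_mono) auto
      finally show ?thesis by (simp add: norm_mult mult_left_mono)
    qed
    then have "bounded ((\<lambda>s. a l * cis (phase x l) * exp (of_real l * s)) ` ?X)"
      unfolding bounded_iff by blast
    then have "uniform_limit ?X (\<lambda>k s. of_real (bochner_fejer_factor k (int_coords N g l)) *
        (a l * cis (phase x l) * exp (of_real l * s)))
      (\<lambda>s. 1 * (a l * cis (phase x l) * exp (of_real l * s))) sequentially"
      by (intro uniform_lim_mult[OF lim uniform_limit_const] bounded_subset[of "{1}" "(\<lambda>s. 1) ` ?X"]) auto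
    then show ?case
      using insert by (auto intro!: uniform_limit_add)
  qed (simp_all add: uniform_limit_const)
  moreover have "bf_sum k a x = (\<lambda>s. \<Sum>l\<in>S \<inter> lattice. of_real (bochner_fejer_factor k (int_coords N g l)) *
      (a l * cis (phase x l) * exp (of_real l * s)))" for k
    by (intro ext bf_sum_finite_support S)
  ultimately show ?thesis
    using S(1) unfolding exp_sum_def by simp
qed

text \<open>Approximate \<open>f\<close> by an exponential polynomial. Its sums converge uniformly,
  and by \<open>bf_sum_norm_le\<close> the sums of \<open>f\<close> stay within the approximation
  error of them for all orders at once, so the sums of \<open>f\<close> are uniformly
  Cauchy.\<close>

lemma bf_sum_uniformly_convergent:
  assumes f: "f \<in> AP \<alpha> \<beta>" and strip: "\<alpha> < ereal \<alpha>1" "ereal \<beta>1 < \<beta>"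
  shows "uniformly_convergent_on {s. \<alpha>1 \<le> Re s \<and> Re s \<le> \<beta>1} (\<lambda>k. bf_sum k (dirichlet_coeff \<alpha> \<beta> f) x)"
proof (intro Cauchy_uniformly_convergent uniformly_Cauchy_onI)
  let ?X = "{s. \<alpha>1 \<le> Re s \<and> Re s \<le> \<beta>1}" and ?dc = "dirichlet_coeff \<alpha> \<beta>"
  fix e :: real assume e: "e > 0"
  show "\<exists>M. \<forall>s\<in>?X. \<forall>m\<ge>M. \<forall>n\<ge>M. dist (bf_sum m (?dc f) x s) (bf_sum n (?dc f) x s) < e"
  proof (cases "\<alpha>1 \<le> \<beta>1")
    case True
    then have ab: "\<alpha> < \<beta>" using strip by (meson ereal_less_eq(3) less_le_trans less_trans)
    have e3: "e / 3 > 0" using e by simp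
    obtain S c where S: "finite S" and
      Sc: "\<And>s. \<alpha>1 \<le> Re s \<Longrightarrow> Re s \<le> \<beta>1 \<Longrightarrow> cmod (f s - exp_sum S c s) < e / 3"
      using AP_approx[OF f strip e3] by blast
    have P: "exp_sum S c \<in> AP \<alpha> \<beta>" using S by (rule exp_sum_AP)
    let ?P = "\<lambda>k s. bf_sum k (?dc (exp_sum S c)) x s" and ?F = "\<lambda>k s. bf_sum k (?dc f) x s"
    have "uniformly_convergent_on ?X (\<lambda>k. bf_sum k (?dc (exp_sum S c)) x)"
      using bf_sum_finite_support_uniform_limit[OF S, of "?dc (exp_sum S c)"] dirichlet_coeff_exp_sum[OF ab S]
      unfolding uniformly_convergent_on_def by auto
    then obtain M where M: "\<And>s m n. s \<in> ?X \<Longrightarrow> m \<ge> M \<Longrightarrow> n \<ge> M \<Longrightarrow> dist (?P m s) (?P n s) < e / 3"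
      using uniformly_convergent_Cauchy e3 unfolding uniformly_Cauchy_on_def by meson
    have near: "dist (?F k s) (?P k s) \<le> e / 3" if s: "s \<in> ?X" for k s
    proof -
      have "\<alpha> < ereal (Re s)" "ereal (Re s) < \<beta>"
        using s strip by (auto intro: less_le_trans[of \<alpha> "ereal \<alpha>1"] le_less_trans[of _ "ereal \<beta>1"])
      moreover have "cmod (f (Complex (Re s) t) - exp_sum S c (Complex (Re s) t)) \<le> e / 3" for t
        using Sc[of "Complex (Re s) t"] s by (auto intro: less_imp_le)
      ultimately show ?thesis
        unfolding dist_norm bf_sum_diff dirichlet_coeff_diff[OF ab f P, symmetric]
        by (intro bf_sum_norm_le[OF AP_diff[OF f P]])
    qed
    have "dist (?F m s) (?F n s) < e" if "s \<in> ?X" "m \<ge> M" "n \<ge> M" for s m n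
      using near[OF that(1), of m] near[OF that(1), of n] M[OF that]
        dist_triangle[of "?F m s" "?F n s" "?P m s"] dist_triangle3[of "?P m s" "?F n s" "?P n s"]
        dist_commute[of "?P m s" "?P n s"] dist_commute[of "?P n s" "?F n s"]
        dist_triangle[of "?P m s" "?F n s" "?P n s"] by linarith
    then show ?thesis by blast
  qed auto
qed

text \<open>The function usually written \<open>f\<close> with index \<open>x\<close>: for exponents
  in the lattice, its Dirichlet series is that of \<open>f\<close> with every term rotated by its
  pairing with \<open>x\<close>.\<close>

definition bf_limit :: "ereal \<Rightarrow> ereal \<Rightarrow> (complex \<Rightarrow> complex) \<Rightarrow> (nat \<Rightarrow> real) \<Rightarrow> complex \<Rightarrow> complex" where
  "bf_limit \<alpha> \<beta> f x s = lim (\<lambda>k. bf_sum k (dirichlet_coeff \<alpha> \<beta> f) x s)"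

lemma bf_sum_uniform_limit:
  assumes "f \<in> AP \<alpha> \<beta>" "\<alpha> < ereal \<alpha>1" "ereal \<beta>1 < \<beta>"
  shows "uniform_limit {s. \<alpha>1 \<le> Re s \<and> Re s \<le> \<beta>1} (\<lambda>k. bf_sum k (dirichlet_coeff \<alpha> \<beta> f) x)
    (bf_limit \<alpha> \<beta> f x) sequentially"
  using bf_sum_uniformly_convergent[OF assms]
  unfolding uniformly_convergent_uniform_limit_iff bf_limit_def .

lemma bf_limit_AP:
  assumes f: "f \<in> AP \<alpha> \<beta>"
  shows "bf_limit \<alpha> \<beta> f x \<in> AP \<alpha> \<beta>"
  unfolding AP_def
proof safe
  fix \<alpha>1 \<beta>1 e :: real assume strip: "\<alpha> < ereal \<alpha>1" "ereal \<beta>1 < \<beta>" and e: "e > 0"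
  obtain K where "\<And>k s. k \<ge> K \<Longrightarrow> \<alpha>1 \<le> Re s \<Longrightarrow> Re s \<le> \<beta>1 \<Longrightarrow>
      dist (bf_sum k (dirichlet_coeff \<alpha> \<beta> f) x s) (bf_limit \<alpha> \<beta> f x s) < e"
    using bf_sum_uniform_limit[OF f strip] e unfolding uniform_limit_sequentially_iff by blast
  then have "\<forall>s. \<alpha>1 \<le> Re s \<and> Re s \<le> \<beta>1 \<longrightarrow>
      cmod (bf_limit \<alpha> \<beta> f x s - bf_sum K (dirichlet_coeff \<alpha> \<beta> f) x s) < e"
    by (simp add: dist_norm norm_minus_commute)
  moreover have "exponential_polynomial (bf_sum K (dirichlet_coeff \<alpha> \<beta> f) x)"
    unfolding exponential_polynomial_exp_sum bf_sum_def using finite_bf_exponents by blast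
  ultimately show "\<exists>P. exponential_polynomial P \<and>
      (\<forall>s. \<alpha>1 \<le> Re s \<and> Re s \<le> \<beta>1 \<longrightarrow> cmod (bf_limit \<alpha> \<beta> f x s - P s) < e)" by blast
qed

text \<open>Coefficients pass to uniform limits on a line. For an exponent in the lattice the
  Bochner-Fejer factor tends to 1; the others occur in no partial sum.\<close>

lemma dirichlet_coeff_bf_limit:
  assumes "\<alpha> < \<beta>" and f: "f \<in> AP \<alpha> \<beta>"
  shows "dirichlet_coeff \<alpha> \<beta> (bf_limit \<alpha> \<beta> f x) l =
    (if l \<in> lattice then dirichlet_coeff \<alpha> \<beta> f l * cis (phase x l) else 0)"
proof -
  let ?a = "dirichlet_coeff \<alpha> \<beta> f" and ?p = "\<lambda>k. bochner_fejer_factor k (int_coords N g l)"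
  obtain \<sigma> where \<sigma>: "\<alpha> < ereal \<sigma>" "ereal \<sigma> < \<beta>" using ereal_dense2[OF assms(1)] by blast
  have "(\<lambda>k. dirichlet_coeff \<alpha> \<beta> (bf_sum k ?a x) l) \<longlonglongrightarrow> dirichlet_coeff \<alpha> \<beta> (bf_limit \<alpha> \<beta> f x) l"
    by (rule dirichlet_coeff_uniform_limit[OF \<sigma> _ bf_limit_AP[OF f] bf_sum_uniform_limit[OF f \<sigma>]])
       (auto simp: bf_sum_def intro: exp_sum_AP finite_bf_exponents)
  moreover have "dirichlet_coeff \<alpha> \<beta> (bf_sum k ?a x) l =
      (if l \<in> lattice then of_real (?p k) * ?a l * cis (phase x l) else 0)" for k
    unfolding bf_sum_def dirichlet_coeff_exp_sum[OF assms(1) finite_bf_exponents]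
    by (auto simp: bf_exponents_def)
  moreover have "(\<lambda>k. if l \<in> lattice then of_real (?p k) * ?a l * cis (phase x l) else 0) \<longlonglongrightarrow>
      (if l \<in> lattice then of_real 1 * ?a l * cis (phase x l) else 0)"
  proof (cases "l \<in> lattice")
    case True
    then have "?p \<longlonglongrightarrow> 1"
      by (intro bochner_fejer_factor_tendsto) (use int_coords_lattice in \<open>auto simp: is_int_coords_def\<close>)
    then show ?thesis using True by (simp only: if_True) (intro tendsto_intros)
  qed auto
  ultimately show ?thesis by (auto intro: LIMSEQ_unique split: if_splits)
qed

end

subsection \<open>Uniqueness of the Dirichlet series\<close>

text \<open>A rational basis of the span of \<open>S\<close>, divided by a common denominator of the
  coordinates of the elements of \<open>S\<close>, gives integer coordinates.\<close>

lemma exists_int_independent_family: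
  assumes "finite S"
  obtains N g where "int_independent_family N g" "\<And>l. l \<in> S \<Longrightarrow> \<exists>r. is_int_coords N g l r"
proof -
  obtain B where B: "B \<subseteq> S" "rat_vs.independent B" "S \<subseteq> rat_vs.span B"
    using rat_vs.maximal_independent_subset[of S] by blast
  have finB: "finite B" using B(1) assms by (rule finite_subset)
  have "\<exists>u. \<mu> = (\<Sum>b\<in>B. rat_scale (u b) b)" if "\<mu> \<in> S" for \<mu>
    using that B(3) unfolding rat_vs.span_finite[OF finB] by auto
  then obtain u where u: "\<And>\<mu>. \<mu> \<in> S \<Longrightarrow> \<mu> = (\<Sum>b\<in>B. rat_scale (u \<mu> b) b)" by metis
  \<comment> \<open>The product of all denominators occurring in the finitely many rational
    coordinates.\<close>
  define D :: int where "D = (\<Prod>(\<mu>, b)\<in>S \<times> B. snd (quotient_of (u \<mu> b)))"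
  have D: "D > 0"
    unfolding D_def by (intro prod_pos) (auto simp: quotient_of_denom_pos')
  have "\<exists>z. of_int D * u \<mu> b = of_int z" if "\<mu> \<in> S" "b \<in> B" for \<mu> b
  proof -
    have "snd (quotient_of (u \<mu> b)) dvd D"
      using dvd_prodI[of "S \<times> B" "(\<mu>, b)" "\<lambda>(\<mu>, b). snd (quotient_of (u \<mu> b))"] that assms finB
      unfolding D_def by simp
    then obtain e where e: "D = snd (quotient_of (u \<mu> b)) * e" by (rule dvdE)
    obtain p q where pq: "quotient_of (u \<mu> b) = (p, q)" by fastforce
    then have "u \<mu> b = of_int p / of_int q" "q > 0"
      using quotient_of_div quotient_of_denom_pos by blast+
    then have "of_int D * u \<mu> b = of_int (e * p)" using e pq by (simp add: mult_ac)
    then show ?thesis by blast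
  qed
  then obtain z where z: "\<And>\<mu> b. \<mu> \<in> S \<Longrightarrow> b \<in> B \<Longrightarrow> of_int D * u \<mu> b = of_int (z \<mu> b)" by metis
  obtain h where h: "bij_betw h {..<card B} B"
    using ex_bij_betw_nat_finite[OF finB] by (auto simp: atLeast0LessThan)
  define g where "g m = h m / of_int D" for m
  have idx: "basis_index (enat (card B)) = {..<card B}" by (auto simp: basis_index_def)
  show ?thesis
  proof (rule that)
    show "int_independent_family (enat (card B)) g"
    proof
      fix I r m assume I: "finite I" "I \<subseteq> basis_index (enat (card B))" "m \<in> I"
        and sum: "(\<Sum>m\<in>I. real_of_int (r m) * g m) = 0"
      have "(\<Sum>m\<in>I. of_int (r m) * h m) = of_int D * (\<Sum>m\<in>I. of_int (r m) * g m)"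
        unfolding g_def sum_distrib_left using D by (intro sum.cong) auto
      then have "(\<Sum>m\<in>I. of_int (r m) * h m) = 0" using sum by simp
      moreover have "rat_vs.independent (h ` {..<card B})" "inj_on h {..<card B}"
        using h B(2) by (auto simp: bij_betw_def)
      ultimately show "r m = 0"
        using rat_independent_imp_int_independent[of h "{..<card B}" I r m] I idx by blast
    qed
    fix l assume l: "l \<in> S"
    define r where "r m = (if m < card B then z l (h m) else 0)" for m
    have "l = (\<Sum>b\<in>B. rat_scale (u l b) b)" using u[OF l] .
    also have "\<dots> = (\<Sum>m<card B. rat_scale (u l (h m)) (h m))"
      by (rule sum.reindex_bij_betw[OF h, symmetric])
    also have "\<dots> = (\<Sum>m<card B. of_int (r m) * g m)"
    proof (intro sum.cong refl)
      fix m assume m: "m \<in> {..<card B}"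
      then have "h m \<in> B" using h by (auto simp: bij_betw_def)
      then have "(of_rat (of_int D * u l (h m)) :: real) = of_rat (of_int (z l (h m)))" using z[OF l] by simp
      then have "of_int D * (of_rat (u l (h m)) :: real) = of_int (z l (h m))" by (simp add: of_rat_mult)
      then show "rat_scale (u l (h m)) (h m) = of_int (r m) * g m"
        using D m by (simp add: rat_scale_def g_def r_def field_simps)
    qed
    also have "\<dots> = (\<Sum>m | r m \<noteq> 0. of_int (r m) * g m)"
      by (rule sum.mono_neutral_right) (auto simp: r_def)
    finally have "l = (\<Sum>m | r m \<noteq> 0. of_int (r m) * g m)" .
    moreover have "{m. r m \<noteq> 0} \<subseteq> {..<card B}" by (auto simp: r_def)
    ultimately have "is_int_coords (enat (card B)) g l r"
      unfolding is_int_coords_def idx using finite_subset by blast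
    then show "\<exists>r. is_int_coords (enat (card B)) g l r" by blast
  qed
qed

text \<open>Let \<open>P\<close> approximate \<open>h\<close> within \<open>e / 2\<close> on the
  line. Since \<open>h\<close> has no coefficients, the Bochner-Fejer sums of \<open>P\<close> are
  those of \<open>P - h\<close> and are bounded by \<open>e / 2\<close>. They converge to
  \<open>P\<close>, so \<open>P\<close> and hence \<open>h\<close> are small at
  \<open>s\<close>.\<close>

lemma AP_uniqueness:
  assumes h: "h \<in> AP \<alpha> \<beta>" and zero: "\<And>l. dirichlet_coeff \<alpha> \<beta> h l = 0"
    and s: "\<alpha> < ereal (Re s)" "ereal (Re s) < \<beta>"
  shows "h s = 0"
proof -
  have ab: "\<alpha> < \<beta>" using s by (rule less_trans)
  have "cmod (h s) \<le> e" if e: "e > 0" for e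
  proof -
    from e have e2: "e / 2 > 0" by simp
    obtain S c where S: "finite S"
      and Sc: "\<And>s'. Re s \<le> Re s' \<Longrightarrow> Re s' \<le> Re s \<Longrightarrow> cmod (h s' - exp_sum S c s') < e / 2"
      using AP_approx[OF h s e2] by blast
    let ?P = "exp_sum S c" and ?a = "dirichlet_coeff \<alpha> \<beta> (exp_sum S c)"
    \<comment> \<open>The family depends on the approximant: its lattice has to contain all
      exponents of \<open>P\<close>, so that the sums of \<open>P\<close> converge to
      \<open>P\<close> itself.\<close>
    obtain N g where "int_independent_family N g" and coords: "\<And>l. l \<in> S \<Longrightarrow> \<exists>r. is_int_coords N g l r"
      using exists_int_independent_family[OF S] by blast
    interpret int_independent_family N g by fact
    have P: "?P \<in> AP \<alpha> \<beta>" using S by (rule exp_sum_AP)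
    have a: "?a = (\<lambda>l. if l \<in> S then c l else 0)"
      using dirichlet_coeff_exp_sum[OF ab S] by blast
    have "cmod (bf_sum k (dirichlet_coeff \<alpha> \<beta> (\<lambda>s. ?P s - h s)) (\<lambda>_. 0) s) \<le> e / 2" for k
    proof (rule bf_sum_norm_le[OF AP_diff[OF P h] s])
      show "cmod (?P (Complex (Re s) t) - h (Complex (Re s) t)) \<le> e / 2" for t
        using Sc[of "Complex (Re s) t"] by (simp add: norm_minus_commute)
    qed
    then have "cmod (bf_sum k ?a (\<lambda>_. 0) s) \<le> e / 2" for k
      unfolding dirichlet_coeff_diff[OF ab P h] zero by simp
    moreover have "(\<lambda>k. bf_sum k ?a (\<lambda>_. 0) s) \<longlonglongrightarrow> exp_sum (S \<inter> lattice) (\<lambda>l. ?a l * cis (phase (\<lambda>_. 0) l)) s"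
      by (rule tendsto_uniform_limitI[OF bf_sum_finite_support_uniform_limit[OF S, of _ _ "Re s" "Re s"]])
         (auto simp: a)
    moreover have "exp_sum (S \<inter> lattice) (\<lambda>l. ?a l * cis (phase (\<lambda>_. 0) l)) s = ?P s"
      using coords by (auto simp: exp_sum_def a phase_def lattice_def intro!: sum.cong)
    ultimately have "cmod (?P s) \<le> e / 2"
      by (intro LIMSEQ_le_const2[OF tendsto_norm]) auto
    then show ?thesis using Sc[of s] norm_triangle_ineq[of "h s - ?P s" "?P s"] by simp
  qed
  then have "cmod (h s) \<le> 0" by (rule field_le_epsilon[of _ 0, simplified])
  then show ?thesis by simp
qed

section \<open>Rational linear maps and symmetry of equivalence\<close>

lemma rat_linear_on_sum:
  assumes \<psi>: "rat_linear_on V \<psi>" and V: "rat_vs.subspace V"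
    and A: "finite A" "\<And>m. m \<in> A \<Longrightarrow> g m \<in> V"
  shows "\<psi> (\<Sum>m\<in>A. of_int (r m) * g m) = (\<Sum>m\<in>A. of_int (r m) * \<psi> (g m))"
proof -
  have scale: "of_int (r m) * y = rat_scale (of_int (r m)) y" for m y by (simp add: rat_scale_def)
  have "0 \<in> V" using rat_vs.subspace_0[OF V] .
  then have "\<psi> (rat_scale 0 0) = rat_scale 0 (\<psi> 0)" using \<psi> unfolding rat_linear_on_def by blast
  then have \<psi>0: "\<psi> 0 = 0" by (simp add: rat_scale_def)
  \<comment> \<open>Additivity of \<open>\<psi>\<close> is known only on \<open>V\<close>, so
    membership of the partial sums is carried through the induction.\<close>
  have "(\<Sum>m\<in>A. of_int (r m) * g m) \<in> V \<and> \<psi> (\<Sum>m\<in>A. of_int (r m) * g m) = (\<Sum>m\<in>A. of_int (r m) * \<psi> (g m))"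
    using A
  proof (induction A)
    case empty
    then show ?case using \<psi>0 \<open>0 \<in> V\<close> by simp
  next
    case (insert m A)
    have m: "of_int (r m) * g m \<in> V" "\<psi> (of_int (r m) * g m) = of_int (r m) * \<psi> (g m)"
      using insert.prems \<psi> rat_vs.subspace_scale[OF V] unfolding scale rat_linear_on_def by auto
    show ?case
      using insert m \<psi> rat_vs.subspace_add[OF V] unfolding rat_linear_on_def by simp
  qed
  then show ?thesis ..
qed

lemma rat_linear_on_uminus: "rat_linear_on V \<psi> \<Longrightarrow> rat_linear_on V (\<lambda>v. - \<psi> v)"
  by (simp add: rat_linear_on_def rat_scale_def)

lemma dirichlet_equiv_sym:
  assumes "dirichlet_equiv \<alpha> \<beta> \<Lambda> f1 f"
  shows "dirichlet_equiv \<alpha> \<beta> \<Lambda> f f1"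
proof -
  obtain \<psi> where \<psi>: "rat_linear_on (rat_vs.span \<Lambda>) \<psi>" and D: "f1 \<in> D_class \<alpha> \<beta> \<Lambda>" "f \<in> D_class \<alpha> \<beta> \<Lambda>"
    and eq: "\<And>l. l \<in> \<Lambda> \<Longrightarrow> dirichlet_coeff \<alpha> \<beta> f1 l = dirichlet_coeff \<alpha> \<beta> f l * exp (\<i> * of_real (\<psi> l))"
    using assms unfolding dirichlet_equiv_def by blast
  have "dirichlet_coeff \<alpha> \<beta> f l = dirichlet_coeff \<alpha> \<beta> f1 l * exp (\<i> * of_real (- \<psi> l))" if "l \<in> \<Lambda>" for l
    unfolding eq[OF that] mult.assoc exp_add[symmetric] by simp
  then show ?thesis
    unfolding dirichlet_equiv_def using D rat_linear_on_uminus[OF \<psi>] by blast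
qed

subsection \<open>Equivalence and the auxiliary function\<close>

context int_independent_family
begin

lemma phase_add: "phase (\<lambda>m. x m + y m) l = phase x l + phase y l"
  by (simp add: phase_def distrib_left sum.distrib)

text \<open>Rotations compose additively. This turns a change of coefficients within an equivalence
  class into a change of the point \<open>x\<close>.\<close>

lemma bf_sum_twist: "bf_sum k (\<lambda>l. a l * cis (phase y l)) x s = bf_sum k a (\<lambda>m. x m + y m) s"
  by (simp add: bf_sum_def exp_sum_def phase_add cis_mult[symmetric] mult_ac del: cis_mult)

lemma bf_sum_cong:
  assumes "\<And>m. m \<in> bf_index k \<Longrightarrow> x m = y m"
  shows "bf_sum k a x s = bf_sum k a y s"
  unfolding bf_sum_box using assms by (simp cong: sum.cong)

text \<open>The coordinates being integers, each pairing changes by a multiple of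
  \<open>2 * pi\<close>; the sum is thus a function on the torus.\<close>

lemma bf_sum_periodic: "bf_sum k a (\<lambda>m. x m + 2 * pi * of_int (h m)) s = bf_sum k a x s"
proof -
  have "cis (\<Sum>m\<in>bf_index k. of_int (r m) * (x m + 2 * pi * of_int (h m))) =
      cis (\<Sum>m\<in>bf_index k. of_int (r m) * x m)" for r :: "nat \<Rightarrow> int"
  proof -
    have "(\<Sum>m\<in>bf_index k. of_int (r m) * (x m + 2 * pi * of_int (h m))) =
        (\<Sum>m\<in>bf_index k. of_int (r m) * x m) + 2 * pi * of_int (\<Sum>m\<in>bf_index k. r m * h m)"
      by (simp add: distrib_left sum.distrib sum_distrib_left mult_ac)
    moreover have "cis (2 * pi * of_int (\<Sum>m\<in>bf_index k. r m * h m)) = 1"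
      by (rule cis_multiple_2pi) (rule Ints_of_int)
    ultimately show ?thesis by (simp only: cis_mult[symmetric] mult_1_right)
  qed
  then show ?thesis unfolding bf_sum_box by simp
qed

lemma bf_sum_tendsto:
  assumes "\<And>m. m \<in> bf_index k \<Longrightarrow> (\<lambda>j. Y j m) \<longlonglongrightarrow> x m"
  shows "(\<lambda>j. bf_sum k a (Y j) s) \<longlonglongrightarrow> bf_sum k a x s"
  unfolding bf_sum_box cis_conv_exp by (intro tendsto_intros assms)

lemma bf_index_lessThan: obtains n where "bf_index k = {..<n}"
proof (cases N)
  case (enat n)
  have "bf_index k = {..<min n k}" unfolding bf_index_def basis_index_def unfolding enat by auto
  then show ?thesis using that by blast
next
  case infinity
  have "bf_index k = {..<k}" unfolding bf_index_def basis_index_def unfolding infinity by auto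
  then show ?thesis using that by blast
qed

text \<open>Kronecker's theorem for the numbers \<open>g m / (2 * pi)\<close>: the rescaling turns
  approximation modulo \<open>2 * pi\<close> into approximation modulo 1 and preserves integer
  independence.\<close>

lemma kronecker_bf_index:
  assumes e: "e > 0"
  obtains t h where "\<And>m. m \<in> bf_index k \<Longrightarrow> \<bar>t * g m - 2 * pi * of_int (h m) - x m\<bar> < e"
proof -
  obtain n where n: "bf_index k = {..<n}" by (rule bf_index_lessThan)
  define \<theta> where "\<theta> m = g m / (2 * pi)" for m
  interpret Z: Modules.module "\<lambda>r. (*) (real_of_int r)"
    by (simp add: Modules.module.intro distrib_left mult.commute)
  have indep: "r m = 0" if "I \<subseteq> {..<n}" "(\<Sum>m\<in>I. of_int (r m) * \<theta> m) = 0" "m \<in> I" for I r m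
  proof -
    have "(\<Sum>m\<in>I. real_of_int (r m) * g m) = 2 * pi * (\<Sum>m\<in>I. of_int (r m) * \<theta> m)"
      by (simp add: \<theta>_def sum_distrib_left)
    then show ?thesis
      using that n bf_index_subset finite_subset[OF that(1)] by (intro int_independent[of I r m]) auto
  qed
  have inj: "inj_on \<theta> {..<n}"
  proof (rule inj_onI, rule ccontr)
    fix i j assume ij: "i \<in> {..<n}" "j \<in> {..<n}" "\<theta> i = \<theta> j" "i \<noteq> j"
    \<comment> \<open>Equal values at \<open>i\<close> and \<open>j\<close> would give the integer
      relation with coefficients 1 at \<open>i\<close> and -1 at \<open>j\<close>.\<close>
    then have "(if i = i then 1 else -1) = (0::int)"
      by (intro indep[of "{i, j}" "\<lambda>m. if m = i then 1 else -1" i]) auto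
    then show False by simp
  qed
  have "Z.independent (\<theta> ` {..<n})"
    unfolding Z.dependent_explicit
  proof clarify
    fix U u v assume U: "finite U" "U \<subseteq> \<theta> ` {..<n}" "v \<in> U" "u v \<noteq> 0" "(\<Sum>v\<in>U. of_int (u v) * v) = 0"
    define I where "I = {m \<in> {..<n}. \<theta> m \<in> U}"
    have bij: "bij_betw \<theta> I U"
      using U(2) inj by (auto simp: bij_betw_def I_def inj_on_def)
    obtain m where m: "m \<in> I" "\<theta> m = v" using bij U(3) by (auto simp: bij_betw_def)
    have "(\<Sum>m\<in>I. of_int (u (\<theta> m)) * \<theta> m) = 0"
      using U(5) sum.reindex_bij_betw[OF bij, of "\<lambda>v. of_int (u v) * v"] by simp
    then have "u (\<theta> m) = 0"
      using m by (intro indep[of I "\<lambda>m. u (\<theta> m)"]) (auto simp: I_def)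
    then show False using m U(4) by simp
  qed
  moreover have "e / (2 * pi) > 0" using e by simp
  ultimately obtain t h where th: "\<And>i. i < n \<Longrightarrow> \<bar>t * \<theta> i - of_int (h i) - x i / (2 * pi)\<bar> < e / (2 * pi)"
    using Kronecker_thm_1[OF _ inj, of "e / (2 * pi)" "\<lambda>i. x i / (2 * pi)"] by metis
  have "\<bar>t * g m - 2 * pi * of_int (h m) - x m\<bar> < e" if "m \<in> bf_index k" for m
  proof -
    have "t * g m - 2 * pi * of_int (h m) - x m = 2 * pi * (t * \<theta> m - of_int (h m) - x m / (2 * pi))"
      by (simp add: \<theta>_def field_simps)
    then have "\<bar>t * g m - 2 * pi * of_int (h m) - x m\<bar> = 2 * pi * \<bar>t * \<theta> m - of_int (h m) - x m / (2 * pi)\<bar>"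
      by (simp add: abs_mult)
    also have "\<dots> < 2 * pi * (e / (2 * pi))"
      using th[of m] that n by (intro mult_strict_left_mono) auto
    finally show ?thesis by simp
  qed
  then show ?thesis by (rule that)
qed

text \<open>A sum of order \<open>k\<close> involves finitely many coordinates and is continuous and
  periodic in them, so it suffices that the line \<open>t * g\<close> comes arbitrarily close to
  \<open>x\<close> on the torus. The unrotated sum at height \<open>t\<close> is the sum at the
  point \<open>t * g\<close>.\<close>

lemma bf_sum_kronecker:
  assumes e: "e > 0"
  obtains t where "dist (bf_sum k a (\<lambda>_. 0) (Complex \<sigma> t)) (bf_sum k a x (Complex \<sigma> 0)) < e"
proof -
  have "\<exists>t h. \<forall>m\<in>bf_index k. \<bar>t * g m - 2 * pi * of_int (h m :: int) - x m\<bar> < inverse (Suc j)" for j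
    using kronecker_bf_index[of "inverse (Suc j)" k x] by (metis inverse_positive_iff_positive of_nat_0_less_iff zero_less_Suc)
  then obtain t h where th:
    "\<And>j m. m \<in> bf_index k \<Longrightarrow> \<bar>t j * g m - 2 * pi * of_int (h j m :: int) - x m\<bar> < inverse (Suc j)"
    by metis
  define Y where "Y j m = t j * g m - 2 * pi * of_int (h j m)" for j m
  have "(\<lambda>j. Y j m) \<longlonglongrightarrow> x m" if "m \<in> bf_index k" for m
  proof (rule LIM_zero_cancel)
    show "(\<lambda>j. Y j m - x m) \<longlonglongrightarrow> 0"
      by (rule Lim_null_comparison[OF _ LIMSEQ_inverse_real_of_nat])
         (auto intro!: always_eventually less_imp_le th[OF that] simp: Y_def simp del: of_nat_Suc)
  qed
  then have "(\<lambda>j. bf_sum k a (Y j) (Complex \<sigma> 0)) \<longlonglongrightarrow> bf_sum k a x (Complex \<sigma> 0)"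
    by (rule bf_sum_tendsto)
  then obtain j where j: "dist (bf_sum k a (Y j) (Complex \<sigma> 0)) (bf_sum k a x (Complex \<sigma> 0)) < e"
    using e unfolding lim_sequentially by blast
  have "bf_sum k a (\<lambda>_. 0) (Complex \<sigma> (t j)) = bf_sum k a (\<lambda>m. Y j m + 2 * pi * of_int (h j m)) (Complex \<sigma> 0)"
    unfolding bf_sum_translate[of _ _ _ \<sigma> "t j"] by (simp add: Y_def)
  also have "\<dots> = bf_sum k a (Y j) (Complex \<sigma> 0)" by (rule bf_sum_periodic)
  finally have "dist (bf_sum k a (\<lambda>_. 0) (Complex \<sigma> (t j))) (bf_sum k a x (Complex \<sigma> 0)) < e"
    using j by simp
  then show ?thesis by (rule that)
qed

text \<open>Without rotation the limit has the same Dirichlet coefficients as \<open>f\<close>,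
  since all exponents of \<open>f\<close> lie in the lattice; uniqueness identifies the two
  functions.\<close>

lemma bf_limit_zero:
  assumes f: "f \<in> AP \<alpha> \<beta>" and supp: "\<And>l. dirichlet_coeff \<alpha> \<beta> f l \<noteq> 0 \<Longrightarrow> l \<in> lattice"
    and s: "\<alpha> < ereal (Re s)" "ereal (Re s) < \<beta>"
  shows "bf_limit \<alpha> \<beta> f (\<lambda>_. 0) s = f s"
proof -
  have ab: "\<alpha> < \<beta>" using s by (rule less_trans)
  have "bf_limit \<alpha> \<beta> f (\<lambda>_. 0) s - f s = 0"
  proof (rule AP_uniqueness[OF AP_diff[OF bf_limit_AP[OF f] f] _ s])
    show "dirichlet_coeff \<alpha> \<beta> (\<lambda>s. bf_limit \<alpha> \<beta> f (\<lambda>_. 0) s - f s) l = 0" for l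
      unfolding dirichlet_coeff_diff[OF ab bf_limit_AP[OF f] f] dirichlet_coeff_bf_limit[OF ab f]
      using supp[of l] by (auto simp: phase_def)
  qed
  then show ?thesis by simp
qed

lemma bf_limit_translate:
  "bf_limit \<alpha> \<beta> f x (Complex \<sigma> t) = bf_limit \<alpha> \<beta> f (\<lambda>m. x m + t * g m) (Complex \<sigma> 0)"
  unfolding bf_limit_def bf_sum_translate[of _ _ _ \<sigma> t] by simp

lemma bf_limit_cong:
  assumes "\<And>m. m \<in> basis_index N \<Longrightarrow> x m = y m"
  shows "bf_limit \<alpha> \<beta> f x s = bf_limit \<alpha> \<beta> f y s"
  unfolding bf_limit_def using assms bf_index_subset by (subst bf_sum_cong[of _ x y]) auto

lemma bf_limit_in_closure:
  assumes f: "f \<in> AP \<alpha> \<beta>" and supp: "\<And>l. dirichlet_coeff \<alpha> \<beta> f l \<noteq> 0 \<Longrightarrow> l \<in> lattice"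
    and \<sigma>: "\<alpha> < ereal \<sigma>" "ereal \<sigma> < \<beta>"
  shows "bf_limit \<alpha> \<beta> f x (Complex \<sigma> 0) \<in> closure (Img_line f \<sigma>)"
  unfolding closure_approachable
proof (intro allI impI)
  fix e :: real assume "e > 0"
  then have e3: "e / 3 > 0" by simp
  let ?a = "dirichlet_coeff \<alpha> \<beta> f" and ?X = "{s. \<sigma> \<le> Re s \<and> Re s \<le> \<sigma>}"
  \<comment> \<open>The order \<open>k\<close> is fixed before the height \<open>t\<close> is found,
    so the estimate for the unrotated sum must hold on the whole line at once.\<close>
  have "\<forall>\<^sub>F k in sequentially. (\<forall>s\<in>?X. dist (bf_sum k ?a x s) (bf_limit \<alpha> \<beta> f x s) < e / 3) \<and>
      (\<forall>s\<in>?X. dist (bf_sum k ?a (\<lambda>_. 0) s) (bf_limit \<alpha> \<beta> f (\<lambda>_. 0) s) < e / 3)"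
    by (intro eventually_conj uniform_limitD[OF bf_sum_uniform_limit[OF f \<sigma>]] e3)
  then obtain k where k1: "\<forall>s\<in>?X. dist (bf_sum k ?a x s) (bf_limit \<alpha> \<beta> f x s) < e / 3"
      and k2: "\<forall>s\<in>?X. dist (bf_sum k ?a (\<lambda>_. 0) s) (bf_limit \<alpha> \<beta> f (\<lambda>_. 0) s) < e / 3"
    using eventually_happens' sequentially_bot by blast
  have k: "dist (bf_sum k ?a x (Complex \<sigma> 0)) (bf_limit \<alpha> \<beta> f x (Complex \<sigma> 0)) < e / 3"
    "dist (bf_sum k ?a (\<lambda>_. 0) (Complex \<sigma> t)) (f (Complex \<sigma> t)) < e / 3" for t
    using bf_limit_zero[OF f supp, of "Complex \<sigma> t"] \<sigma>
      k1[rule_format, of "Complex \<sigma> 0"] k2[rule_format, of "Complex \<sigma> t"] by auto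
  obtain t where t: "dist (bf_sum k ?a (\<lambda>_. 0) (Complex \<sigma> t)) (bf_sum k ?a x (Complex \<sigma> 0)) < e / 3"
    using bf_sum_kronecker[OF e3] .
  have "dist (f (Complex \<sigma> t)) (bf_limit \<alpha> \<beta> f x (Complex \<sigma> 0)) < e"
    using k(1) k(2)[of t] t
      dist_triangle3[of "f (Complex \<sigma> t)" "bf_sum k ?a x (Complex \<sigma> 0)" "bf_sum k ?a (\<lambda>_. 0) (Complex \<sigma> t)"]
      dist_triangle[of "f (Complex \<sigma> t)" "bf_limit \<alpha> \<beta> f x (Complex \<sigma> 0)" "bf_sum k ?a x (Complex \<sigma> 0)"]
    by linarith
  then show "\<exists>y\<in>Img_line f \<sigma>. dist y (bf_limit \<alpha> \<beta> f x (Complex \<sigma> 0)) < e"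
    unfolding Img_line_def by blast
qed

end

section \<open>Equivalent functions and the image of the auxiliary function\<close>

locale integral_basis_family =
  fixes \<Lambda> :: "real set" and N :: enat and g :: "nat \<Rightarrow> real"
  assumes basis: "integral_basis \<Lambda> N g"
begin

sublocale int_independent_family N g
  using basis rat_independent_imp_int_independent[of g "basis_index N"]
  unfolding integral_basis_def by unfold_locales blast

lemma \<Lambda>_lattice: "l \<in> \<Lambda> \<Longrightarrow> l \<in> lattice"
  using basis by (auto simp: integral_basis_def lattice_def)

lemma D_class_lattice: "f \<in> D_class \<alpha> \<beta> \<Lambda> \<Longrightarrow> dirichlet_coeff \<alpha> \<beta> f l \<noteq> 0 \<Longrightarrow> l \<in> lattice"
  using \<Lambda>_lattice by (auto simp: D_class_def)

text \<open>The two sums differ by lattice exponents outside \<open>\<Lambda>\<close>, where the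
  coefficients of \<open>f\<close> vanish.\<close>

lemma aux_fun_eq_bf_limit:
  assumes f: "f \<in> D_class \<alpha> \<beta> \<Lambda>"
  shows "aux_fun \<alpha> \<beta> \<Lambda> N g f \<sigma> x = bf_limit \<alpha> \<beta> f x (Complex \<sigma> 0)"
proof -
  have "(\<Sum>l | l \<in> \<Lambda> \<and> bochner_fejer_factor k (int_coords N g l) \<noteq> 0.
      of_real (bochner_fejer_factor k (int_coords N g l)) * dirichlet_coeff \<alpha> \<beta> f l *
      exp (\<i> * of_real (\<Sum>m | int_coords N g l m \<noteq> 0. of_int (int_coords N g l m) * x m)) *
      of_real (exp (l * \<sigma>))) = bf_sum k (dirichlet_coeff \<alpha> \<beta> f) x (Complex \<sigma> 0)" for k
    unfolding bf_sum_def exp_sum_def exp_line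
  proof (rule sum.mono_neutral_cong_left[OF finite_bf_exponents])
    show "\<forall>l\<in>bf_exponents k - {l. l \<in> \<Lambda> \<and> bochner_fejer_factor k (int_coords N g l) \<noteq> 0}.
        of_real (bochner_fejer_factor k (int_coords N g l)) * dirichlet_coeff \<alpha> \<beta> f l * cis (phase x l) *
        (of_real (exp (l * \<sigma>)) * cis (l * 0)) = 0"
      using f by (auto simp: D_class_def bf_exponents_def)
  qed (use \<Lambda>_lattice in \<open>auto simp: bf_exponents_def phase_def cis_conv_exp\<close>)
  then show ?thesis unfolding aux_fun_def bf_limit_def by simp
qed

text \<open>By linearity \<open>\<psi>\<close> is determined on \<open>\<Lambda>\<close> by its
  values at the basis, so it acts as the rotation with \<open>x m = \<psi> (g m)\<close>.\<close>

lemma phase_eq: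
  assumes \<psi>: "rat_linear_on (rat_vs.span \<Lambda>) \<psi>" and l: "l \<in> \<Lambda>"
  shows "phase (\<lambda>m. \<psi> (g m)) l = \<psi> l"
proof -
  let ?r = "int_coords N g l"
  have r: "finite {m. ?r m \<noteq> 0}" "{m. ?r m \<noteq> 0} \<subseteq> basis_index N" "l = (\<Sum>m | ?r m \<noteq> 0. of_int (?r m) * g m)"
    using int_coords_lattice[OF \<Lambda>_lattice[OF l]] unfolding is_int_coords_def by blast+
  have "g m \<in> rat_vs.span \<Lambda>" if "m \<in> basis_index N" for m
    using basis that rat_vs.span_base[of "g m" "g ` basis_index N"] unfolding integral_basis_def by auto
  then have "\<psi> (\<Sum>m | ?r m \<noteq> 0. of_int (?r m) * g m) = phase (\<lambda>m. \<psi> (g m)) l"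
    unfolding phase_def using r(1,2) by (intro rat_linear_on_sum[OF \<psi> rat_vs.subspace_span]) auto
  then show ?thesis using r(3) by metis
qed

text \<open>The coefficients of \<open>f1\<close> are those of \<open>f\<close> rotated by
  \<open>\<psi>\<close>, so the unrotated sums of \<open>f1\<close> are the sums of \<open>f\<close>
  at \<open>y m = \<psi> (g m)\<close>. The former converge to \<open>f1\<close> by
  uniqueness.\<close>

lemma dirichlet_equiv_bf_limit:
  assumes eq: "dirichlet_equiv \<alpha> \<beta> \<Lambda> f1 f"
  obtains y where "\<And>\<sigma> t. \<alpha> < ereal \<sigma> \<Longrightarrow> ereal \<sigma> < \<beta> \<Longrightarrow>
    f1 (Complex \<sigma> t) = bf_limit \<alpha> \<beta> f (\<lambda>m. y m + t * g m) (Complex \<sigma> 0)"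
proof -
  obtain \<psi> where \<psi>: "rat_linear_on (rat_vs.span \<Lambda>) \<psi>" and D: "f1 \<in> D_class \<alpha> \<beta> \<Lambda>" "f \<in> D_class \<alpha> \<beta> \<Lambda>"
    and coeff: "\<And>l. l \<in> \<Lambda> \<Longrightarrow> dirichlet_coeff \<alpha> \<beta> f1 l = dirichlet_coeff \<alpha> \<beta> f l * exp (\<i> * of_real (\<psi> l))"
    using eq unfolding dirichlet_equiv_def by blast
  define y where "y = (\<lambda>m. \<psi> (g m))"
  have f1: "f1 \<in> AP \<alpha> \<beta>" using D by (simp add: D_class_def)
  have "dirichlet_coeff \<alpha> \<beta> f1 l = dirichlet_coeff \<alpha> \<beta> f l * cis (phase y l)" for l
  proof (cases "l \<in> \<Lambda>")
    case True
    then show ?thesis using coeff phase_eq[OF \<psi>] by (simp add: y_def cis_conv_exp)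
  next
    case False
    then have "dirichlet_coeff \<alpha> \<beta> f1 l = 0" "dirichlet_coeff \<alpha> \<beta> f l = 0" using D by (auto simp: D_class_def)
    then show ?thesis by simp
  qed
  then have "dirichlet_coeff \<alpha> \<beta> f1 = (\<lambda>l. dirichlet_coeff \<alpha> \<beta> f l * cis (phase y l))" by blast
  then have lim: "bf_limit \<alpha> \<beta> f1 (\<lambda>_. 0) s = bf_limit \<alpha> \<beta> f y s" for s
    unfolding bf_limit_def by (simp add: bf_sum_twist)
  have "f1 (Complex \<sigma> t) = bf_limit \<alpha> \<beta> f (\<lambda>m. y m + t * g m) (Complex \<sigma> 0)"
    if "\<alpha> < ereal \<sigma>" "ereal \<sigma> < \<beta>" for \<sigma> t
    using bf_limit_zero[OF f1 D_class_lattice[OF D(1)], of "Complex \<sigma> t"] that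
    unfolding lim bf_limit_translate[of _ _ _ y] by simp
  then show ?thesis by (rule that)
qed

lemma dirichlet_equiv_imp_closure:
  assumes eq: "dirichlet_equiv \<alpha> \<beta> \<Lambda> f1 f" and \<sigma>: "\<alpha> < ereal \<sigma>" "ereal \<sigma> < \<beta>"
  shows "Img_line f1 \<sigma> \<subseteq> closure (Img_line f \<sigma>)"
proof -
  have D: "f \<in> D_class \<alpha> \<beta> \<Lambda>" using eq by (simp add: dirichlet_equiv_def)
  then have f: "f \<in> AP \<alpha> \<beta>" by (simp add: D_class_def)
  obtain y where y: "\<And>t. f1 (Complex \<sigma> t) = bf_limit \<alpha> \<beta> f (\<lambda>m. y m + t * g m) (Complex \<sigma> 0)"
    using dirichlet_equiv_bf_limit[OF eq] \<sigma> by metis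
  show ?thesis
    unfolding Img_line_def[of f1] y using bf_limit_in_closure[OF f D_class_lattice[OF D] \<sigma>] by blast
qed

text \<open>Conversely, every \<open>x\<close> arises from a rational linear map: values on an
  independent set can be prescribed freely and extended linearly.\<close>

lemma bf_limit_dirichlet_equiv:
  assumes ab: "\<alpha> < \<beta>" and D: "f \<in> D_class \<alpha> \<beta> \<Lambda>"
  shows "dirichlet_equiv \<alpha> \<beta> \<Lambda> (bf_limit \<alpha> \<beta> f x) f"
proof -
  interpret vector_space_pair rat_scale rat_scale
    by (simp add: vector_space_pair_def rat_vs.vector_space_axioms)
  have inj: "inj_on g (basis_index N)" and indep: "rat_vs.independent (g ` basis_index N)"
    using basis by (auto simp: integral_basis_def)
  from linear_independent_extend[OF indep, of "\<lambda>v. x (the_inv_into (basis_index N) g v)"]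
  obtain \<psi> where lin: "Vector_Spaces.linear rat_scale rat_scale \<psi>"
    and \<psi>: "\<And>m. m \<in> basis_index N \<Longrightarrow> \<psi> (g m) = x m"
    using the_inv_into_f_f[OF inj] by force
  have lin': "rat_linear_on (rat_vs.span \<Lambda>) \<psi>"
    unfolding rat_linear_on_def using linear_add[OF lin] linear_scale[OF lin] by blast
  have f: "f \<in> AP \<alpha> \<beta>" using D by (simp add: D_class_def)
  have phase: "phase x l = \<psi> l" if "l \<in> \<Lambda>" for l
  proof -
    have "phase x l = phase (\<lambda>m. \<psi> (g m)) l"
      using \<psi> int_coords_lattice[OF \<Lambda>_lattice[OF that]]
      unfolding phase_def is_int_coords_def by (intro sum.cong) auto
    then show ?thesis using phase_eq[OF lin' that] by simp
  qed
  note coeff = dirichlet_coeff_bf_limit[OF ab f, of x]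
  have "l \<in> \<Lambda>" if "dirichlet_coeff \<alpha> \<beta> (bf_limit \<alpha> \<beta> f x) l \<noteq> 0" for l
    using that D coeff[of l] by (auto simp: D_class_def split: if_splits)
  then have "bf_limit \<alpha> \<beta> f x \<in> D_class \<alpha> \<beta> \<Lambda>"
    using bf_limit_AP[OF f] unfolding D_class_def by blast
  moreover have "dirichlet_coeff \<alpha> \<beta> (bf_limit \<alpha> \<beta> f x) l = dirichlet_coeff \<alpha> \<beta> f l * exp (\<i> * of_real (\<psi> l))"
    if "l \<in> \<Lambda>" for l
    unfolding coeff using \<Lambda>_lattice[OF that] phase[OF that] by (simp add: cis_conv_exp)
  ultimately show ?thesis unfolding dirichlet_equiv_def using D lin' by blast
qed

lemma Img_aux_eq:
  assumes D: "f \<in> D_class \<alpha> \<beta> \<Lambda>" and \<sigma>: "\<alpha> < ereal \<sigma>" "ereal \<sigma> < \<beta>"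
  shows "Img_aux \<alpha> \<beta> \<Lambda> N g f \<sigma> = (\<Union>f1 \<in> {f1. dirichlet_equiv \<alpha> \<beta> \<Lambda> f1 f}. Img_line f1 \<sigma>)"
proof (intro equalityI subsetI)
  fix z assume "z \<in> Img_aux \<alpha> \<beta> \<Lambda> N g f \<sigma>"
  then obtain x where "z = bf_limit \<alpha> \<beta> f x (Complex \<sigma> 0)"
    unfolding Img_aux_def aux_fun_eq_bf_limit[OF D] by blast
  \<comment> \<open>The function \<open>bf_limit \<alpha> \<beta> f x\<close> is itself equivalent
    to \<open>f\<close>, and \<open>z\<close> is its value at height 0.\<close>
  then show "z \<in> (\<Union>f1 \<in> {f1. dirichlet_equiv \<alpha> \<beta> \<Lambda> f1 f}. Img_line f1 \<sigma>)"
    using bf_limit_dirichlet_equiv[OF less_trans[OF \<sigma>] D, of x] unfolding Img_line_def by blast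
next
  fix z assume "z \<in> (\<Union>f1 \<in> {f1. dirichlet_equiv \<alpha> \<beta> \<Lambda> f1 f}. Img_line f1 \<sigma>)"
  then obtain f1 t where eq: "dirichlet_equiv \<alpha> \<beta> \<Lambda> f1 f" and z: "z = f1 (Complex \<sigma> t)"
    unfolding Img_line_def by blast
  obtain y where y: "z = bf_limit \<alpha> \<beta> f (\<lambda>m. y m + t * g m) (Complex \<sigma> 0)"
    using dirichlet_equiv_bf_limit[OF eq] \<sigma> z by metis
  \<comment> \<open>\<open>Img_aux\<close> ranges over extensional points, so the rotation is cut
    down to the index set of the basis.\<close>
  let ?y = "restrict (\<lambda>m. y m + t * g m) (basis_index N)"
  have "z = bf_limit \<alpha> \<beta> f ?y (Complex \<sigma> 0)" unfolding y by (rule bf_limit_cong) simp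
  moreover have "?y \<in> basis_index N \<rightarrow>\<^sub>E UNIV" by simp
  ultimately show "z \<in> Img_aux \<alpha> \<beta> \<Lambda> N g f \<sigma>"
    unfolding Img_aux_def aux_fun_eq_bf_limit[OF D] by blast
qed

end

theorem proposition2:
  fixes \<alpha> \<beta> :: ereal and \<Lambda> :: "real set" and f :: "complex \<Rightarrow> complex"
    and s0 :: complex and \<sigma>0 :: real
  assumes "\<alpha> < \<beta>"
    and "countable \<Lambda>"
    and "\<exists>N g. integral_basis \<Lambda> N g"
    and "f \<in> D_class \<alpha> \<beta> \<Lambda>"
    and "s0 \<in> vstrip \<alpha> \<beta>"
    and "\<sigma>0 = Re s0"
  shows "(\<forall>f1. dirichlet_equiv \<alpha> \<beta> \<Lambda> f1 f \<longrightarrow>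
            Img_line f1 \<sigma>0 \<subseteq> closure (Img_line f \<sigma>0) \<and>
            closure (Img_line f \<sigma>0) = closure (Img_line f1 \<sigma>0)) \<and>
         (\<forall>N g. integral_basis \<Lambda> N g \<longrightarrow>
            Img_aux \<alpha> \<beta> \<Lambda> N g f \<sigma>0 = (\<Union>f1 \<in> {f1. dirichlet_equiv \<alpha> \<beta> \<Lambda> f1 f}. Img_line f1 \<sigma>0))"
proof -
  have \<sigma>: "\<alpha> < ereal \<sigma>0" "ereal \<sigma>0 < \<beta>" using assms(5,6) by (auto simp: vstrip_def)
  \<comment> \<open>Stated for an arbitrary pair, since equality of the closures uses it in both
    directions.\<close>
  have sub: "Img_line f1 \<sigma>0 \<subseteq> closure (Img_line f2 \<sigma>0)" if "dirichlet_equiv \<alpha> \<beta> \<Lambda> f1 f2" for f1 f2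
  proof -
    obtain N g where "integral_basis \<Lambda> N g" using assms(3) by blast
    then interpret integral_basis_family \<Lambda> N g by unfold_locales
    show ?thesis by (rule dirichlet_equiv_imp_closure[OF that \<sigma>])
  qed
  have "Img_line f1 \<sigma>0 \<subseteq> closure (Img_line f \<sigma>0) \<and> closure (Img_line f \<sigma>0) = closure (Img_line f1 \<sigma>0)"
    if "dirichlet_equiv \<alpha> \<beta> \<Lambda> f1 f" for f1
    using sub[OF that] sub[OF dirichlet_equiv_sym[OF that]] by (simp add: closure_minimal subset_antisym)
  moreover have "Img_aux \<alpha> \<beta> \<Lambda> N g f \<sigma>0 = (\<Union>f1 \<in> {f1. dirichlet_equiv \<alpha> \<beta> \<Lambda> f1 f}. Img_line f1 \<sigma>0)"
    if "integral_basis \<Lambda> N g" for N g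
  proof -
    interpret integral_basis_family \<Lambda> N g using that by unfold_locales
    show ?thesis by (rule Img_aux_eq[OF assms(4) \<sigma>])
  qed
  ultimately show ?thesis by blast
qed

end
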